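(* Let $(K,I,J,g,q)$ be a finite stochastic game with initial state $k\in K$, and suppose it is absorbing, i.e. every state $\ell\neq k$ satisfies $q(\ell\,|\,\ell,i,j)=1$ for all $(i,j)\in I\times J$. Let $(x_\lambda,y_\lambda)_{\lambda\in(0,1]}$ be a fixed family of optimal stationary strategies admitting Puiseux expansions near $0$, and let $(\sigma^\theta,\tau^\theta)$ be the associated family of strategy pairs indexed by the evaluations $\theta$ (defined in the context). Then $$\lim_{\|\theta\|\to 0}\gamma_\theta^k(\sigma^\theta,\tau^\theta;t)=t\,v^k\qquad\text{for all } t\in[0,1].$$
   Context: Game. $K=\{1,\dots,n\}$ (states), $I,J$ (actions of Players 1 and 2) are finite sets, $g:K\times I\times J\to\mathbb{R}$ is the reward function and $q:K\times I\times J\to\Delta(K)$ the transition function, where $\Delta(S)$ denotes the probability distributions on a finite set $S$; $q(\ell'\,|\,\ell,i,j)$ is the probability of $\ell'$ under $q(\ell,i,j)$. The play starts at $k_1=k$. At each stage $m\ge1$, knowing the past history and the current state $k_m$, the players choose simultaneously and independently $i_m\in I$ and $j_m\in J$, and $k_{m+1}$ is drawn from $q(k_m,i_m,j_m)$; states and actions are observed. Strategies. A strategy of Player 1 is $\sigma=(\sigma_m)_{m\ge1}$ with $\sigma_m:(K\times I\times J)^{m-1}\times K\to\Delta(I)$; strategies $\tau$ of Player 2 are defined similarly with $\Delta(J)$. A stationary strategy is a map $x:K\to\Delta(I)$ (resp. $y:K\to\Delta(J)$), played at each stage according to the current state only; $x^\ell(i)$ is the probability of $i$ at state $\ell$. $\mathbb{E}^k_{\sigma,\tau}$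 is the expectation for the law on plays induced by $(\sigma,\tau)$, $k_1=k$ and $q$. Evaluations and payoffs. An evaluation is a sequence $\theta=(\theta_m)_{m\ge1}$ of nonnegative reals with $\sum_{m\ge1}\theta_m=1$; $\|\theta\|:=\max_{m\ge1}\theta_m$. For $t\in[0,1]$, $\varphi(\theta,t):=\inf\{M\ge1:\sum_{m=1}^M\theta_m\ge t\}$ (with $\inf\emptyset=+\infty$), and the cumulated payoff at time $t$ is $$\gamma_\theta^k(\sigma,\tau;t):=\mathbb{E}^k_{\sigma,\tau}\Big[\sum_{m=1}^{\varphi(\theta,t)}\theta_m\,g(k_m,i_m,j_m)\Big].$$ The $\theta$-evaluated game with initial state $k$ is the zero-sum game with payoff $\gamma_\theta^k(\sigma,\tau;1)$, maximized by Player 1 and minimized by Player 2; it has a value $v_\theta^k$. The $\lambda$-discounted game, $\lambda\in(0,1]$, is the case $\theta_m=\lambda(1-\lambda)^{m-1}$, with value $v_\lambda^k$, and $v^k:=\lim_{\lambda\to0}v_\lambda^k$, which exists. A limit as $\|\theta\|\to0$ is taken over all evaluations $\theta$. The strategies $(\sigma^\theta,\tau^\theta)$. For each $\lambda\in(0,1]$ let $x_\lambda,y_\lambda$ be stationary strategies that are optimal in the $\lambda$-discounted game for every initial state (i.e. $x_\lambda$ guarantees at least, and $y_\lambda$ at most, the value $v_\lambda^\ell$ for every $\ell$ against any strategy), such that $\lambda\mapsto x_\lambda^\ell(i)$ and $\lambda\mapsto y_\lambda^\ell(j)$ admit Puiseux expansions near $0$ for all $\ell,i,j$ (i.e. for $\lambda>0$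 small they equal $\sum_{r\ge0}a_r\lambda^{r/N}$, a convergent series, for some integer $N\ge1$). For an evaluation $\theta$ and $m\ge1$ set $\lambda_m^\theta:=\theta_m/\sum_{m'\ge m}\theta_{m'}$, and let $(\sigma^\theta,\tau^\theta)$ be the pair of strategies that plays, at each stage $m$, according to $(x_{\lambda_m^\theta},y_{\lambda_m^\theta})$ at the current state. Conventions: $(x_0,y_0):=\lim_{\lambda\to0}(x_\lambda,y_\lambda)$; if $\sum_{m'\ge m}\theta_{m'}=0$ play at stage $m$ is arbitrary. *)

theory Defs
  imports "HOL-Probability.Probability"
begin

text \<open>
  States, actions of Player 1 and actions of Player 2 are the elements of finite types
  \<open>'k\<close>, \<open>'i\<close>, \<open>'j\<close>. Stages are numbered from 0 here: the stage that is usually called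
  \<open>m \<ge> 1\<close> is stage \<open>m - 1\<close>, so \<open>\<theta> 0\<close> is the weight of the first stage, and a strategy, which
  takes the finite history of (state, action, action) triples and the current state, acts at
  stage \<open>m\<close> when the history has length \<open>m\<close>.
\<close>

type_synonym ('k, 'i, 'j, 'a) strategy = "('k \<times> 'i \<times> 'j) list \<Rightarrow> 'k \<Rightarrow> 'a pmf"

definition stationary :: "('k \<Rightarrow> 'a pmf) \<Rightarrow> ('k, 'i, 'j, 'a) strategy" where
  "stationary x = (\<lambda>h s. x s)"

definition absorbing_game :: "('k \<Rightarrow> 'i \<Rightarrow> 'j \<Rightarrow> 'k pmf) \<Rightarrow> 'k \<Rightarrow> bool" where
  "absorbing_game q k \<longleftrightarrow> (\<forall>l. l \<noteq> k \<longrightarrow> (\<forall>i j. pmf (q l i j) l = 1))"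


subsection \<open>The law on plays\<close>

definition state_kernel ::
  "('k \<Rightarrow> 'i \<Rightarrow> 'j \<Rightarrow> 'k pmf) \<Rightarrow> 'k \<Rightarrow> nat \<Rightarrow> (nat \<Rightarrow> 'k \<times> 'i \<times> 'j) \<Rightarrow> 'k pmf" where
  "state_kernel q k m \<omega> =
     (if m = 0 then return_pmf k else (case \<omega> (m - 1) of (s, i, j) \<Rightarrow> q s i j))"

text \<open>The conditional law of the triple of stage \<open>m\<close>; it depends on \<open>\<omega> 0, \<dots>, \<omega> (m - 1)\<close> only.\<close>

definition stage_kernel ::
  "('k \<Rightarrow> 'i \<Rightarrow> 'j \<Rightarrow> 'k pmf) \<Rightarrow> 'k \<Rightarrow> ('k, 'i, 'j, 'i) strategy \<Rightarrow> ('k, 'i, 'j, 'j) strategy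
     \<Rightarrow> nat \<Rightarrow> (nat \<Rightarrow> 'k \<times> 'i \<times> 'j) \<Rightarrow> ('k \<times> 'i \<times> 'j) pmf" where
  "stage_kernel q k \<sigma> \<tau> m \<omega> =
     bind_pmf (state_kernel q k m \<omega>) (\<lambda>s.
       map_pmf (Pair s) (pair_pmf (\<sigma> (map \<omega> [0..<m]) s) (\<tau> (map \<omega> [0..<m]) s)))"

text \<open>
  The law on infinite plays is the projective limit that the Ionescu-Tulcea theorem provides for
  these kernels; \<open>Ionescu_Tulcea_stage_kernel\<close> below shows that the theorem applies.
\<close>

definition play_law ::
  "('k \<Rightarrow> 'i \<Rightarrow> 'j \<Rightarrow> 'k pmf) \<Rightarrow> 'k \<Rightarrow> ('k, 'i, 'j, 'i) strategy \<Rightarrow> ('k, 'i, 'j, 'j) strategy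
     \<Rightarrow> (nat \<Rightarrow> 'k \<times> 'i \<times> 'j) measure" where
  "play_law q k \<sigma> \<tau> =
     projective_family.lim UNIV
       (Ionescu_Tulcea.CI (\<lambda>m \<omega>. measure_pmf (stage_kernel q k \<sigma> \<tau> m \<omega>)) (\<lambda>_. count_space UNIV))
       (\<lambda>_. count_space UNIV)"

lemma Ionescu_Tulcea_stage_kernel:
  fixes q :: "'k::finite \<Rightarrow> 'i::finite \<Rightarrow> 'j::finite \<Rightarrow> 'k pmf"
  shows "Ionescu_Tulcea (\<lambda>m \<omega>. measure_pmf (stage_kernel q k \<sigma> \<tau> m \<omega>)) (\<lambda>_. count_space UNIV)"
proof
  fix m :: nat
  have "PiM {0..<m} (\<lambda>_. count_space (UNIV :: ('k \<times> 'i \<times> 'j) set)) =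
      count_space (PiE {0..<m} (\<lambda>_. UNIV))"
    by (rule count_space_PiM_finite) auto
  then show "(\<lambda>\<omega>. measure_pmf (stage_kernel q k \<sigma> \<tau> m \<omega>))
      \<in> measurable (PiM {0..<m} (\<lambda>_. count_space UNIV)) (subprob_algebra (count_space UNIV))"
    by (simp add: measure_pmf_in_subprob_algebra)
qed

lemma prob_space_play_law:
  fixes q :: "'k::finite \<Rightarrow> 'i::finite \<Rightarrow> 'j::finite \<Rightarrow> 'k pmf"
  shows "prob_space (play_law q k \<sigma> \<tau>)"
proof -
  interpret IT: Ionescu_Tulcea
    "\<lambda>m \<omega>. measure_pmf (stage_kernel q k \<sigma> \<tau> m \<omega>)" "\<lambda>_. count_space UNIV"
    by (rule Ionescu_Tulcea_stage_kernel)
  interpret CI: prob_space "IT.CI {}"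
    by (rule IT.PF.prob_space_P) auto
  have "emeasure IT.PF.lim (IT.PF.emb UNIV {} (space (PiM {} (\<lambda>_. count_space UNIV)))) = 1"
    using CI.emeasure_space_1 by (subst IT.lim) (auto simp: IT.CI_def)
  moreover have "IT.PF.emb UNIV {} (space (PiM {} (\<lambda>_. count_space UNIV))) = space IT.PF.lim"
    by (auto simp: prod_emb_def space_PiM)
  ultimately show ?thesis
    unfolding play_law_def by (intro prob_spaceI) simp
qed


subsection \<open>Evaluations and payoffs\<close>

definition evaluation :: "(nat \<Rightarrow> real) \<Rightarrow> bool" where
  "evaluation \<theta> \<longleftrightarrow> (\<forall>m. 0 \<le> \<theta> m) \<and> \<theta> sums 1"

text \<open>For an evaluation the supremum is attained, since its terms tend to 0.\<close>

definition eval_norm :: "(nat \<Rightarrow> real) \<Rightarrow> real" where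
  "eval_norm \<theta> = (SUP m. \<theta> m)"

text \<open>The filter for limits over all evaluations as their norm tends to 0.\<close>

definition vanishing :: "(nat \<Rightarrow> real) filter" where
  "vanishing = inf (filtercomap eval_norm (nhds 0)) (principal {\<theta>. evaluation \<theta>})"

lemma eventually_vanishing:
  "eventually P vanishing \<longleftrightarrow>
     (\<exists>\<delta>>0. \<forall>\<theta>. evaluation \<theta> \<and> \<bar>eval_norm \<theta>\<bar> < \<delta> \<longrightarrow> P \<theta>)"
  unfolding vanishing_def eventually_inf_principal eventually_filtercomap eventually_nhds_metric
  by (auto simp: dist_real_def)

text \<open>The number of stages, possibly infinite, until the fraction \<open>t\<close> of the weight is used up.\<close>

definition clock :: "(nat \<Rightarrow> real) \<Rightarrow> real \<Rightarrow> enat" where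
  "clock \<theta> t = Inf (enat ` {M. M \<ge> 1 \<and> (\<Sum>m<M. \<theta> m) \<ge> t})"

definition payoff ::
  "('k \<Rightarrow> 'i \<Rightarrow> 'j \<Rightarrow> real) \<Rightarrow> ('k \<Rightarrow> 'i \<Rightarrow> 'j \<Rightarrow> 'k pmf) \<Rightarrow> (nat \<Rightarrow> real) \<Rightarrow> 'k
     \<Rightarrow> ('k, 'i, 'j, 'i) strategy \<Rightarrow> ('k, 'i, 'j, 'j) strategy \<Rightarrow> real \<Rightarrow> real" where
  "payoff g q \<theta> k \<sigma> \<tau> t =
     (\<integral>\<omega>. (\<Sum>m. if enat m < clock \<theta> t then \<theta> m * (case \<omega> m of (s, i, j) \<Rightarrow> g s i j) else 0)
        \<partial>play_law q k \<sigma> \<tau>)"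

definition is_value ::
  "('k \<Rightarrow> 'i \<Rightarrow> 'j \<Rightarrow> real) \<Rightarrow> ('k \<Rightarrow> 'i \<Rightarrow> 'j \<Rightarrow> 'k pmf) \<Rightarrow> (nat \<Rightarrow> real) \<Rightarrow> 'k \<Rightarrow> real \<Rightarrow> bool" where
  "is_value g q \<theta> k w \<longleftrightarrow>
     (SUP \<sigma>. INF \<tau>. payoff g q \<theta> k \<sigma> \<tau> 1) = w \<and> (INF \<tau>. SUP \<sigma>. payoff g q \<theta> k \<sigma> \<tau> 1) = w"

definition game_value ::
  "('k \<Rightarrow> 'i \<Rightarrow> 'j \<Rightarrow> real) \<Rightarrow> ('k \<Rightarrow> 'i \<Rightarrow> 'j \<Rightarrow> 'k pmf) \<Rightarrow> (nat \<Rightarrow> real) \<Rightarrow> 'k \<Rightarrow> real" where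
  "game_value g q \<theta> k = (THE w. is_value g q \<theta> k w)"

definition discounted :: "real \<Rightarrow> nat \<Rightarrow> real" where
  "discounted lam m = lam * (1 - lam) ^ m"

definition limit_value ::
  "('k \<Rightarrow> 'i \<Rightarrow> 'j \<Rightarrow> real) \<Rightarrow> ('k \<Rightarrow> 'i \<Rightarrow> 'j \<Rightarrow> 'k pmf) \<Rightarrow> 'k \<Rightarrow> real" where
  "limit_value g q k = Lim (at_right 0) (\<lambda>lam. game_value g q (discounted lam) k)"


subsection \<open>Optimal stationary strategies and the strategies they induce\<close>

definition optimal1 ::
  "('k \<Rightarrow> 'i \<Rightarrow> 'j \<Rightarrow> real) \<Rightarrow> ('k \<Rightarrow> 'i \<Rightarrow> 'j \<Rightarrow> 'k pmf) \<Rightarrow> real \<Rightarrow> ('k \<Rightarrow> 'i pmf) \<Rightarrow> bool" where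
  "optimal1 g q lam x \<longleftrightarrow>
     (\<forall>l \<tau>. payoff g q (discounted lam) l (stationary x) \<tau> 1 \<ge> game_value g q (discounted lam) l)"

definition optimal2 ::
  "('k \<Rightarrow> 'i \<Rightarrow> 'j \<Rightarrow> real) \<Rightarrow> ('k \<Rightarrow> 'i \<Rightarrow> 'j \<Rightarrow> 'k pmf) \<Rightarrow> real \<Rightarrow> ('k \<Rightarrow> 'j pmf) \<Rightarrow> bool" where
  "optimal2 g q lam y \<longleftrightarrow>
     (\<forall>l \<sigma>. payoff g q (discounted lam) l \<sigma> (stationary y) 1 \<le> game_value g q (discounted lam) l)"

definition puiseux_near_0 :: "(real \<Rightarrow> real) \<Rightarrow> bool" where
  "puiseux_near_0 f \<longleftrightarrow>
     (\<exists>N::nat. N \<ge> 1 \<and> (\<exists>a :: nat \<Rightarrow> real.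
        \<forall>\<^sub>F lam in at_right 0. (\<lambda>r. a r * lam powr (real r / real N)) sums f lam))"

text \<open>
  Only the members \<open>x lam\<close> with \<open>0 < lam \<le> 1\<close> belong to the given family; whatever the function
  \<open>x\<close> does at \<open>0\<close> is overridden by the limit of the family there.
\<close>

definition extend_at_0 :: "(real \<Rightarrow> 'k \<Rightarrow> 'a pmf) \<Rightarrow> real \<Rightarrow> 'k \<Rightarrow> 'a pmf" where
  "extend_at_0 x lam s =
     (if lam = 0 then embed_pmf (\<lambda>a. Lim (at_right 0) (\<lambda>\<mu>. pmf (x \<mu> s) a)) else x lam s)"

definition tail :: "(nat \<Rightarrow> real) \<Rightarrow> nat \<Rightarrow> real" where
  "tail \<theta> m = (\<Sum>r. \<theta> (m + r))"

text \<open>Nothing is required at stages where the remaining weight is 0: play is arbitrary there.\<close>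

definition follows ::
  "(real \<Rightarrow> 'k \<Rightarrow> 'a pmf) \<Rightarrow> (nat \<Rightarrow> real) \<Rightarrow> ('k, 'i, 'j, 'a) strategy \<Rightarrow> bool" where
  "follows x \<theta> \<sigma> \<longleftrightarrow>
     (\<forall>h s. tail \<theta> (length h) \<noteq> 0 \<longrightarrow>
        \<sigma> h s = extend_at_0 x (\<theta> (length h) / tail \<theta> (length h)) s)"

end

theory Submission
  imports Defs "HOL-Complex_Analysis.Complex_Analysis"
begin

text \<open>
  Write \<open>u\<close>, \<open>p\<close>, \<open>c\<close> for the stage reward at \<open>k\<close>, the probability of leaving \<open>k\<close>, and the
  expected value of the absorbing state reached, all under \<open>(x\<^sub>\<lambda>, y\<^sub>\<lambda>)\<close>, and \<open>v\<close> for the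
  \<open>\<lambda>\<close>-discounted value at \<open>k\<close>, so that \<open>\<lambda> (u - v) + (1 - \<lambda>) (c - v p) = 0\<close>. Comparing the
  \<open>\<lambda>\<close>- and \<open>\<mu>\<close>-discounted payoffs of \<open>(x\<^sub>\<lambda>, y\<^sub>\<mu>)\<close> and letting \<open>\<mu> \<longlongrightarrow> \<lambda>\<close> from both sides gives the
  envelope identity \<open>(u - v) - (c - v p) = v' (\<lambda> + (1 - \<lambda>) p)\<close>, where \<open>v'\<close> is the derivative in \<open>\<lambda>\<close>.
  Hence both \<open>\<lambda> (u - v)\<close> and \<open>c - v p\<close> are bounded by \<open>\<bar>\<lambda> v'\<bar> (\<lambda> + p)\<close>, and \<open>\<lambda> v'\<close> tends to 0
  because \<open>v\<close>, a bounded quotient of Puiseux series, is a Puiseux series itself.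

  Along the play of \<open>(\<sigma>\<^sup>\<theta>, \<tau>\<^sup>\<theta>)\<close>, let \<open>S\<^sub>m\<close> be the probability of still being at \<open>k\<close>. As long as
  the remaining weight is at least \<open>\<epsilon>\<close>, the sum of \<open>S\<^sub>m (\<lambda>\<^sub>m + p\<^sub>m)\<close> is at most \<open>1 / \<epsilon> + 1\<close>, so the
  bounds above keep the expected stage payoffs close to the limit value.
\<close>

subsection \<open>Law of a stage under Markov strategies\<close>

text \<open>\<open>X m\<close> and \<open>Y m\<close> give the mixed actions at stage
  \<open>m\<close> from the current state alone. Stationary strategies, and those induced by an
  evaluation as long as weight remains, have this form, so the law of the state obeys a recursion on
  finite distributions.\<close>

primrec state_law ::
  "('k \<Rightarrow> 'i \<Rightarrow> 'j \<Rightarrow> 'k pmf) \<Rightarrow> 'k \<Rightarrow> (nat \<Rightarrow> 'k \<Rightarrow> 'i pmf) \<Rightarrow> (nat \<Rightarrow> 'k \<Rightarrow> 'j pmf) \<Rightarrow> nat \<Rightarrow> 'k pmf"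
where
  "state_law q k X Y 0 = return_pmf k"
| "state_law q k X Y (Suc m) =
     bind_pmf (state_law q k X Y m) (\<lambda>s. bind_pmf (pair_pmf (X m s) (Y m s)) (\<lambda>(i, j). q s i j))"

definition stage_law ::
  "('k \<Rightarrow> 'i \<Rightarrow> 'j \<Rightarrow> 'k pmf) \<Rightarrow> 'k \<Rightarrow> (nat \<Rightarrow> 'k \<Rightarrow> 'i pmf) \<Rightarrow> (nat \<Rightarrow> 'k \<Rightarrow> 'j pmf) \<Rightarrow> nat
     \<Rightarrow> ('k \<times> 'i \<times> 'j) pmf" where
  "stage_law q k X Y m =
     bind_pmf (state_law q k X Y m) (\<lambda>s. map_pmf (Pair s) (pair_pmf (X m s) (Y m s)))"

text \<open>The kernel of a stage sees the past only through the preceding triple, so the marginals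
  follow by induction. Agreement with \<open>X\<close> and \<open>Y\<close> is asked for only up to
  stage \<open>m\<close>, because play is arbitrary once the remaining weight is 0.\<close>

lemma distr_play_law:
  fixes q :: "'k::finite \<Rightarrow> 'i::finite \<Rightarrow> 'j::finite \<Rightarrow> 'k pmf"
  assumes \<sigma>: "\<And>h s. length h \<le> m \<Longrightarrow> \<sigma> h s = X (length h) s"
    and \<tau>: "\<And>h s. length h \<le> m \<Longrightarrow> \<tau> h s = Y (length h) s"
  shows "distr (play_law q k \<sigma> \<tau>) (count_space UNIV) (\<lambda>\<omega>. \<omega> m) =
    measure_pmf (stage_law q k X Y m)"
proof -
  let ?N = "count_space (UNIV :: ('k \<times> 'i \<times> 'j) set)"
  let ?P = "\<lambda>m \<omega>. measure_pmf (stage_kernel q k \<sigma> \<tau> m \<omega>)"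
  let ?u = "\<lambda>_. undefined"
  interpret IT: Ionescu_Tulcea ?P "\<lambda>_. ?N"
    by (rule Ionescu_Tulcea_stage_kernel)
  have u: "?u \<in> space (PiM {0..<0} (\<lambda>_. ?N))"
    by (simp add: space_PiM PiE_iff extensional_def)
  \<comment> \<open>Appending a coordinate to a path of length \<open>n\<close> and reading it off
    again leaves just the kernel of stage \<open>n\<close>.\<close>
  have C: "distr (IT.C 0 (Suc n) ?u) ?N (\<lambda>\<omega>. \<omega> n) = IT.C 0 n ?u \<bind> ?P n" for n
  proof -
    have ne: "space (IT.C 0 n ?u) \<noteq> {}"
      using IT.prob_space_C[OF u] prob_space.not_empty by blast
    have "distr (IT.C 0 (Suc n) ?u) ?N (\<lambda>\<omega>. \<omega> n)
        = IT.C 0 n ?u \<bind> (\<lambda>\<omega>. distr (IT.eP n \<omega>) ?N (\<lambda>\<omega>. \<omega> n))"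
      using ne IT.measurable_eP[of n]
      by (simp, subst distr_bind[where K="PiM {0..<Suc n} (\<lambda>_. ?N)"])
        (auto intro!: measurable_component_singleton
           simp: measurable_cong_sets[OF IT.sets_C[OF u] refl])
    also have "\<dots> = IT.C 0 n ?u \<bind> ?P n"
    proof (rule bind_cong)
      fix \<omega> assume "\<omega> \<in> space (IT.C 0 n ?u)"
      then have \<omega>: "\<omega> \<in> space (PiM {0..<n} (\<lambda>_. ?N))"
        using IT.space_C[OF u] by simp
      have 1: "(\<lambda>\<omega>. \<omega> n) \<in> measurable (PiM {0..<Suc n} (\<lambda>_. ?N)) ?N"
        by (rule measurable_component_singleton) simp
      have 2: "fun_upd \<omega> n \<in> measurable (?P n \<omega>) (PiM {0..<Suc n} (\<lambda>_. ?N))"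
        using \<omega> by (auto simp: space_PiM PiE_iff extensional_def)
      show "distr (IT.eP n \<omega>) ?N (\<lambda>\<omega>. \<omega> n) = ?P n \<omega>"
        unfolding IT.eP_def distr_distr[OF 1 2] by (simp add: comp_def distr_id2)
    qed simp
    finally show ?thesis .
  qed
  have D: "distr (IT.C 0 (Suc n) ?u) ?N (\<lambda>\<omega>. \<omega> n) = measure_pmf (stage_law q k X Y n)"
    if "n \<le> m" for n
    using that
  proof (induction n)
    case 0
    have "?P 0 \<omega> = measure_pmf (stage_law q k X Y 0)" for \<omega>
      using \<sigma>[of "[]"] \<tau>[of "[]"]
      by (simp add: stage_kernel_def state_kernel_def stage_law_def)
    then have "IT.C 0 0 ?u \<bind> ?P 0 = measure_pmf (stage_law q k X Y 0)"
      using u by (simp add: bind_const' prob_space_return measure_pmf.subprob_space_axioms)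
    then show ?case
      unfolding C .
  next
    case (Suc n)
    \<comment> \<open>One step of the Markov chain of triples. As the kernel of stage
      \<open>Suc n\<close> depends on the path only through \<open>\<omega> n\<close>, it can be
      integrated against the marginal from the induction hypothesis.\<close>
    define K where "K = (\<lambda>(s, i, j). bind_pmf (q s i j) (\<lambda>s'.
        map_pmf (Pair s') (pair_pmf (X (Suc n) s') (Y (Suc n) s'))))"
    have P: "?P (Suc n) \<omega> = measure_pmf (K (\<omega> n))" for \<omega>
      using Suc.prems
      by (simp add: stage_kernel_def state_kernel_def K_def \<sigma> \<tau> split: prod.splits)
    have comp: "(\<lambda>\<omega>. \<omega> n) \<in> measurable (IT.C 0 (Suc n) ?u) ?N"
      using IT.sets_C[OF u, of "Suc n"]
      by (subst measurable_cong_sets[OF _ refl]) (auto intro!: measurable_component_singleton)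
    have ne: "space (IT.C 0 (Suc n) ?u) \<noteq> {}"
      using IT.prob_space_C[OF u] prob_space.not_empty by blast
    have "IT.C 0 (Suc n) ?u \<bind> ?P (Suc n) = IT.C 0 (Suc n) ?u \<bind> (\<lambda>\<omega>. measure_pmf (K (\<omega> n)))"
      by (simp only: P)
    also have "\<dots> = distr (IT.C 0 (Suc n) ?u) ?N (\<lambda>\<omega>. \<omega> n) \<bind> (\<lambda>t. measure_pmf (K t))"
      by (rule bind_distr[symmetric, OF comp _ ne, where K="?N"])
        (simp add: measure_pmf_in_subprob_algebra)
    also have "\<dots> = measure_pmf (bind_pmf (stage_law q k X Y n) K)"
      using Suc by (simp add: measure_pmf_bind)
    also have "bind_pmf (stage_law q k X Y n) K = stage_law q k X Y (Suc n)"
      by (simp add: stage_law_def K_def bind_assoc_pmf bind_map_pmf case_prod_unfold)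
    finally show ?case
      unfolding C[of "Suc n"] .
  qed
  have J: "(\<lambda>\<omega>. \<omega> m) \<in> measurable (PiM {0..<Suc m} (\<lambda>_. ?N)) ?N"
    by (rule measurable_component_singleton) simp
  \<comment> \<open>\<open>IT.CI\<close> is defined through the least horizon containing the index
    set; here that horizon is \<open>Suc m\<close>, which is where \<open>D\<close> applies.\<close>
  have up: "IT.up_to {0..<Suc m} = Suc m"
    by (intro antisym) (auto simp: IT.up_to_iff Suc_le_eq intro: IT.up_to_less)
  have "distr (play_law q k \<sigma> \<tau>) ?N (\<lambda>\<omega>. \<omega> m)
      = distr (distr IT.PF.lim (PiM {0..<Suc m} (\<lambda>_. ?N)) (\<lambda>\<omega>. restrict \<omega> {0..<Suc m})) ?N (\<lambda>\<omega>. \<omega> m)"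
    unfolding play_law_def
    by (subst distr_distr[OF J])
      (auto simp: comp_def measurable_cong_sets[OF IT.PF.sets_lim refl]
            intro!: measurable_restrict measurable_component_singleton)
  also have "\<dots> = distr (IT.CI {0..<Suc m}) ?N (\<lambda>\<omega>. \<omega> m)"
    by (subst IT.distr_lim) auto
  also have "\<dots> = distr (IT.C 0 (Suc m) ?u) ?N (\<lambda>\<omega>. \<omega> m)"
    unfolding IT.CI_def up using IT.sets_C[OF u, of "Suc m"]
    by (subst distr_distr[OF J])
      (auto simp: comp_def measurable_cong_sets[OF IT.sets_C[OF u] refl] simp del: IT.C.simps
            intro!: measurable_restrict measurable_component_singleton)
  also have "\<dots> = measure_pmf (stage_law q k X Y m)"
    by (rule D) simp
  finally show ?thesis .
qed

section \<open>Expectations under independent mixed actions and the laws of single stages\<close>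

definition mix :: "'i::finite pmf \<Rightarrow> 'j::finite pmf \<Rightarrow> ('i \<Rightarrow> 'j \<Rightarrow> real) \<Rightarrow> real" where
  "mix a b f = (\<Sum>i\<in>UNIV. \<Sum>j\<in>UNIV. pmf a i * pmf b j * f i j)"

lemma mix_add: "mix a b (\<lambda>i j. f i j + h i j) = mix a b f + mix a b h"
  by (simp add: mix_def algebra_simps sum.distrib)

lemma mix_diff: "mix a b (\<lambda>i j. f i j - h i j) = mix a b f - mix a b h"
  by (simp add: mix_def algebra_simps sum_subtractf)

lemma mix_cmult: "mix a b (\<lambda>i j. c * f i j) = c * mix a b f"
  by (simp add: mix_def algebra_simps sum_distrib_left)

lemma mix_sum: "mix a b (\<lambda>i j. \<Sum>l\<in>A. f l i j) = (\<Sum>l\<in>A. mix a b (f l))"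
  by (induction A rule: infinite_finite_induct) (simp_all add: mix_add, simp_all add: mix_def)

lemma mix_const [simp]: "mix a b (\<lambda>i j. c) = c"
proof -
  have "mix a b (\<lambda>i j. c) = (\<Sum>i\<in>UNIV. pmf a i * ((\<Sum>j\<in>UNIV. pmf b j) * c))"
    by (simp only: mix_def sum_distrib_left sum_distrib_right mult.assoc)
  then show ?thesis
    by (simp add: sum_pmf_eq_1 flip: sum_distrib_right)
qed

lemma mix_mono: "(\<And>i j. f i j \<le> h i j) \<Longrightarrow> mix a b f \<le> mix a b h"
  unfolding mix_def by (intro sum_mono mult_left_mono) auto

lemma mix_abs_le: "(\<And>i j. \<bar>f i j\<bar> \<le> G) \<Longrightarrow> \<bar>mix a b f\<bar> \<le> G"
  using mix_mono[of f "\<lambda>_ _. G" a b] mix_mono[of "\<lambda>_ _. - G" f a b]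
  by (simp add: abs_le_iff minus_le_iff)

lemma mix_nonneg: "(\<And>i j. 0 \<le> f i j) \<Longrightarrow> 0 \<le> mix a b f"
  using mix_mono[of "\<lambda>_ _. 0" f a b] by simp

lemma abs_mix_le: "\<bar>mix a b f\<bar> \<le> mix a b (\<lambda>i j. \<bar>f i j\<bar>)"
  using mix_mono[of f "\<lambda>i j. \<bar>f i j\<bar>" a b]
    mix_mono[of "\<lambda>i j. (-1) * f i j" "\<lambda>i j. \<bar>f i j\<bar>" a b]
  unfolding mix_cmult by (simp add: abs_le_iff)

lemma tendsto_mix:
  assumes "\<And>i. ((\<lambda>a. pmf (X a) i) \<longlongrightarrow> pmf X0 i) F"
    and "\<And>j. ((\<lambda>a. pmf (Y a) j) \<longlongrightarrow> pmf Y0 j) F"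
  shows "((\<lambda>a. mix (X a) (Y a) f) \<longlongrightarrow> mix X0 Y0 f) F"
  unfolding mix_def by (intro tendsto_intros assms)

lemma expectation_pair_pmf:
  "measure_pmf.expectation (pair_pmf a b) (\<lambda>(i, j). f i j) = mix a b f"
proof -
  have "measure_pmf.expectation (pair_pmf a b) (\<lambda>(i, j). f i j) =
      (\<Sum>(i, j)\<in>UNIV \<times> UNIV. f i j * (pmf a i * pmf b j))"
    by (subst integral_measure_pmf_real[of UNIV])
      (auto simp: UNIV_Times_UNIV pmf_pair intro!: sum.cong)
  then show ?thesis
    by (simp add: mix_def sum.cartesian_product algebra_simps)
qed

lemma expectation_stage_law:
  fixes q :: "'k::finite \<Rightarrow> 'i::finite \<Rightarrow> 'j::finite \<Rightarrow> 'k pmf"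
  shows "measure_pmf.expectation (stage_law q k X Y m) (\<lambda>(s, i, j). g s i j) =
    (\<Sum>s\<in>UNIV. pmf (state_law q k X Y m) s * mix (X m s) (Y m s) (g s))"
proof -
  have "measure_pmf.expectation (stage_law q k X Y m) (\<lambda>(s, i, j). g s i j) =
      (\<Sum>s\<in>UNIV. pmf (state_law q k X Y m) s *\<^sub>R
        measure_pmf.expectation (map_pmf (Pair s) (pair_pmf (X m s) (Y m s))) (\<lambda>(s, i, j). g s i j))"
    unfolding stage_law_def
    by (rule pmf_expectation_bind) auto
  also have "\<dots> = (\<Sum>s\<in>UNIV. pmf (state_law q k X Y m) s * mix (X m s) (Y m s) (g s))"
    by (simp add: expectation_pair_pmf)
  finally show ?thesis .
qed

lemma pmf_state_law_Suc:
  fixes q :: "'k::finite \<Rightarrow> 'i::finite \<Rightarrow> 'j::finite \<Rightarrow> 'k pmf"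
  shows "pmf (state_law q k X Y (Suc m)) l =
    (\<Sum>s\<in>UNIV. pmf (state_law q k X Y m) s * mix (X m s) (Y m s) (\<lambda>i j. pmf (q s i j) l))"
proof -
  have "pmf (bind_pmf (pair_pmf a b) (\<lambda>(i, j). q s i j)) l = mix a b (\<lambda>i j. pmf (q s i j) l)"
    for a b s
    using expectation_pair_pmf[of a b "\<lambda>i j. pmf (q s i j) l"]
    by (simp add: pmf_bind case_prod_unfold)
  then show ?thesis
    unfolding state_law.simps
    by (subst pmf_bind, subst integral_measure_pmf_real[of UNIV]) (auto simp: algebra_simps)
qed

subsection \<open>Evaluations and the clock\<close>

lemma evaluation_summable: "evaluation \<theta> \<Longrightarrow> summable \<theta>"
  by (auto simp: evaluation_def sums_iff)

lemma evaluation_nonneg: "evaluation \<theta> \<Longrightarrow> 0 \<le> \<theta> m"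
  by (auto simp: evaluation_def)

lemma tail_eq: "evaluation \<theta> \<Longrightarrow> tail \<theta> m = 1 - (\<Sum>r<m. \<theta> r)"
  using suminf_minus_initial_segment[of \<theta> m]
  by (simp add: tail_def evaluation_def sums_iff add.commute)

lemma tail_0: "evaluation \<theta> \<Longrightarrow> tail \<theta> 0 = 1"
  by (simp add: tail_eq)

lemma tail_Suc: "evaluation \<theta> \<Longrightarrow> tail \<theta> (Suc m) = tail \<theta> m - \<theta> m"
  by (simp add: tail_eq)

lemma tail_nonneg: "evaluation \<theta> \<Longrightarrow> 0 \<le> tail \<theta> m"
  unfolding tail_def
  using summable_ignore_initial_segment[OF evaluation_summable, of \<theta> m]
  by (intro suminf_nonneg) (simp_all add: evaluation_nonneg add.commute)

lemma tail_antimono: "evaluation \<theta> \<Longrightarrow> m \<le> n \<Longrightarrow> tail \<theta> n \<le> tail \<theta> m"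
  by (rule lift_Suc_antimono_le[of "tail \<theta>"]) (simp_all add: tail_Suc evaluation_nonneg)

lemma weight_le_tail: "evaluation \<theta> \<Longrightarrow> \<theta> m \<le> tail \<theta> m"
  using tail_Suc[of \<theta> m] tail_nonneg[of \<theta> "Suc m"] by simp

text \<open>A nonempty set of extended naturals attains its infimum. Since \<open>M \<ge> 1\<close>
  is demanded, stage 0 counts for every \<open>t\<close>, also for \<open>t = 0\<close>.\<close>

lemma less_clock_iff: "enat m < clock \<theta> t \<longleftrightarrow> (\<forall>M. 1 \<le> M \<and> M \<le> m \<longrightarrow> (\<Sum>r<M. \<theta> r) < t)"
proof -
  let ?A = "enat ` {M. M \<ge> 1 \<and> (\<Sum>m<M. \<theta> m) \<ge> t}"
  have "Inf ?A \<le> enat m \<longleftrightarrow> (\<exists>a\<in>?A. a \<le> enat m)"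
  proof
    assume le: "Inf ?A \<le> enat m"
    then have "?A \<noteq> {}"
      by (auto simp: Inf_enat_def simp del: image_is_empty)
    then have "Inf ?A \<in> ?A"
      unfolding Inf_enat_def by (metis (mono_tags, lifting) LeastI_ex ex_in_conv)
    then show "\<exists>a\<in>?A. a \<le> enat m"
      using le by blast
  qed (blast intro: Inf_lower2)
  then show ?thesis
    unfolding clock_def not_le[symmetric] by auto
qed

text \<open>Before a stage of positive weight the partial sums are still below 1. Hence at time 1
  the clock drops only stages of weight 0, and the payoff is the full one.\<close>

lemma less_clock_one:
  assumes "evaluation \<theta>" and "\<theta> m \<noteq> 0"
  shows "enat m < clock \<theta> 1"
  unfolding less_clock_iff
proof (intro allI impI)
  fix M assume "1 \<le> M \<and> M \<le> m"
  then have "0 < tail \<theta> M"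
    using tail_antimono[of \<theta> M m] weight_le_tail[of \<theta> m] evaluation_nonneg[of \<theta> m] assms by force
  then show "(\<Sum>r<M. \<theta> r) < 1"
    using assms(1) by (simp add: tail_eq)
qed

lemma weight_le_eval_norm: "evaluation \<theta> \<Longrightarrow> \<theta> m \<le> eval_norm \<theta>"
  unfolding eval_norm_def
proof (rule cSUP_upper)
  assume \<theta>: "evaluation \<theta>"
  have "\<theta> m \<le> 1" for m
    using weight_le_tail[OF \<theta>, of m] tail_antimono[OF \<theta>, of 0 m] tail_0[OF \<theta>] by simp
  then show "bdd_above (range \<theta>)"
    by (intro bdd_aboveI[of _ 1]) auto
qed simp

text \<open>The weight counted overshoots \<open>t\<close> by at most that of the last stage. If the
  clock never stops, all partial sums are below \<open>t\<close>, which forces \<open>t = 1\<close>,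
  and then there is no error.\<close>

lemma clock_weight:
  assumes \<theta>: "evaluation \<theta>" and t: "0 \<le> t" "t \<le> 1"
  shows "\<bar>(\<Sum>m. if enat m < clock \<theta> t then \<theta> m else 0) - t\<bar> \<le> eval_norm \<theta>"
proof (cases "clock \<theta> t")
  case infinity
  have sums: "(\<lambda>M. \<Sum>r<M. \<theta> r) \<longlonglongrightarrow> 1"
    using \<theta> by (simp add: evaluation_def sums_def)
  have "(\<Sum>r<M. \<theta> r) < t" if "1 \<le> M" for M
    using that infinity less_clock_iff[of M \<theta> t] by simp
  then have "1 \<le> t"
    by (intro LIMSEQ_le_const2[OF sums]) (auto intro: exI[of _ 1] less_imp_le)
  then have "(\<Sum>m. if enat m < clock \<theta> t then \<theta> m else 0) = t"
    using t \<theta> infinity by (simp add: evaluation_def sums_iff)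
  then show ?thesis
    using weight_le_eval_norm[OF \<theta>, of 0] evaluation_nonneg[OF \<theta>, of 0] by simp
next
  case (enat M)
  have "\<not> enat M < clock \<theta> t"
    using enat by simp
  then obtain M' where M': "1 \<le> M'" "M' \<le> M" "t \<le> (\<Sum>r<M'. \<theta> r)"
    unfolding less_clock_iff by force
  then have "M \<ge> 1"
    by simp
  then have less: "enat (M - 1) < clock \<theta> t"
    using enat by simp
  \<comment> \<open>Stage \<open>M - 1\<close> is still counted, so no admissible index below
    \<open>M\<close> reaches \<open>t\<close>.\<close>
  have "M' = M"
    using M' less unfolding less_clock_iff by (metis Suc_pred' le_SucE less_le_trans less_one not_le One_nat_def)
  have eq: "(\<Sum>m. if enat m < clock \<theta> t then \<theta> m else 0) = (\<Sum>m<M. \<theta> m)"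
    using enat by (subst suminf_finite[of "{..<M}"]) auto
  \<comment> \<open>For \<open>M = 1\<close> the clock says nothing about the empty sum, and
    \<open>0 \<le> t\<close> is used instead.\<close>
  have "(\<Sum>m<M - 1. \<theta> m) \<le> t"
    using less t \<open>M \<ge> 1\<close> unfolding less_clock_iff
    by (cases "M = 1") (auto intro!: less_imp_le dest: spec[of _ "M - 1"])
  moreover have "(\<Sum>m<M. \<theta> m) = (\<Sum>m<M - 1. \<theta> m) + \<theta> (M - 1)"
    using \<open>M \<ge> 1\<close> by (cases M) auto
  ultimately show ?thesis
    using M'(3)[unfolded \<open>M' = M\<close>] weight_le_eval_norm[OF \<theta>, of "M - 1"] unfolding eq by linarith
qed

text \<open>The counted weights are at most \<open>\<theta>\<close>, so replacing \<open>E\<close>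
  by \<open>L\<close> costs at most \<open>D\<close>; replacing their total by \<open>t\<close> then
  costs \<open>\<bar>L\<bar> * eval_norm \<theta>\<close>.\<close>

lemma clocked_average_close:
  fixes E :: "nat \<Rightarrow> real"
  assumes \<theta>: "evaluation \<theta>" and t: "0 \<le> t" "t \<le> 1"
    and bound: "\<And>n. (\<Sum>m<n. \<theta> m * \<bar>E m - L\<bar>) \<le> D"
  shows "\<bar>(\<Sum>m. if enat m < clock \<theta> t then \<theta> m * E m else 0) - t * L\<bar> \<le> D + \<bar>L\<bar> * eval_norm \<theta>"
proof -
  define w where "w m = (if enat m < clock \<theta> t then \<theta> m else 0)" for m
  have w: "0 \<le> w m" "w m \<le> \<theta> m" for m
    using evaluation_nonneg[OF \<theta>] by (auto simp: w_def)
  have sw: "summable w"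
    by (rule summable_comparison_test'[OF evaluation_summable[OF \<theta>], of 0]) (use w in auto)
  have partial: "(\<Sum>m<n. \<bar>w m * (E m - L)\<bar>) \<le> D" for n
    by (rule order_trans[OF sum_mono bound]) (use w in \<open>simp add: abs_mult mult_right_mono\<close>)
  have sd: "summable (\<lambda>m. \<bar>w m * (E m - L)\<bar>)"
    by (rule bounded_imp_summable[of _ D]) (use partial[of "Suc _"] in \<open>auto simp: lessThan_Suc_atMost\<close>)
  have "(\<Sum>m. if enat m < clock \<theta> t then \<theta> m * E m else 0) = (\<Sum>m. w m * (E m - L) + w m * L)"
    by (intro suminf_cong) (simp add: w_def algebra_simps)
  also have "\<dots> = (\<Sum>m. w m * (E m - L)) + (\<Sum>m. w m) * L"
    using summable_rabs_cancel[OF sd] sw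
    by (simp add: suminf_add[symmetric] suminf_mult2 summable_mult2)
  finally have "\<bar>(\<Sum>m. if enat m < clock \<theta> t then \<theta> m * E m else 0) - t * L\<bar> \<le>
      \<bar>\<Sum>m. w m * (E m - L)\<bar> + \<bar>((\<Sum>m. w m) - t) * L\<bar>"
    by (simp add: algebra_simps)
  moreover have "\<bar>\<Sum>m. w m * (E m - L)\<bar> \<le> D"
    using summable_rabs[OF sd] suminf_le_const[OF sd partial] by linarith
  moreover have "\<bar>((\<Sum>m. w m) - t) * L\<bar> \<le> \<bar>L\<bar> * eval_norm \<theta>"
    using mult_right_mono[OF clock_weight[OF assms(1-3)], of "\<bar>L\<bar>"]
    by (simp add: abs_mult w_def mult.commute)
  ultimately show ?thesis
    by linarith
qed

section \<open>Payoffs of Markov strategies as series\<close>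

lemma stage_measurable:
  fixes q :: "'k::finite \<Rightarrow> 'i::finite \<Rightarrow> 'j::finite \<Rightarrow> 'k pmf"
  shows "(\<lambda>\<omega>. \<omega> m) \<in> measurable (play_law q k \<sigma> \<tau>) (count_space UNIV)"
proof -
  interpret IT: Ionescu_Tulcea
    "\<lambda>m \<omega>. measure_pmf (stage_kernel q k \<sigma> \<tau> m \<omega>)" "\<lambda>_. count_space UNIV"
    by (rule Ionescu_Tulcea_stage_kernel)
  show ?thesis
    unfolding play_law_def measurable_cong_sets[OF IT.PF.sets_lim refl]
    by (rule measurable_component_singleton) simp
qed

lemma finite_abs_bound:
  fixes f :: "'a::finite \<Rightarrow> real"
  obtains B where "\<forall>a. \<bar>f a\<bar> \<le> B"
  using member_le_sum[of _ UNIV "\<lambda>a. \<bar>f a\<bar>"] by force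

text \<open>Bounded rewards and summable weights allow the expectation to be taken stage by stage.
  The strategies need to be Markov only while weight remains.\<close>

lemma payoff_markov:
  fixes q :: "'k::finite \<Rightarrow> 'i::finite \<Rightarrow> 'j::finite \<Rightarrow> 'k pmf"
  assumes \<theta>: "evaluation \<theta>"
    and \<sigma>: "\<And>h s. tail \<theta> (length h) \<noteq> 0 \<Longrightarrow> \<sigma> h s = X (length h) s"
    and \<tau>: "\<And>h s. tail \<theta> (length h) \<noteq> 0 \<Longrightarrow> \<tau> h s = Y (length h) s"
  shows "payoff g q \<theta> k \<sigma> \<tau> t =
    (\<Sum>m. if enat m < clock \<theta> t
          then \<theta> m * (\<Sum>s\<in>UNIV. pmf (state_law q k X Y m) s * mix (X m s) (Y m s) (g s)) else 0)"
proof -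
  interpret P: prob_space "play_law q k \<sigma> \<tau>"
    by (rule prob_space_play_law)
  let ?N = "count_space (UNIV :: ('k \<times> 'i \<times> 'j) set)"
  define w where "w m = (if enat m < clock \<theta> t then \<theta> m else 0)" for m
  define G where "G = (\<lambda>(s, i, j). g s i j)"
  obtain B where "\<forall>a. \<bar>G a\<bar> \<le> B"
    by (rule finite_abs_bound)
  then have B: "\<bar>G a\<bar> \<le> B" for a
    by blast
  have w: "0 \<le> w m" "w m \<le> \<theta> m" for m
    using evaluation_nonneg[OF \<theta>] by (auto simp: w_def)
  have sw: "summable w"
    by (rule summable_comparison_test'[OF evaluation_summable[OF \<theta>], of 0]) (use w in auto)
  have G_meas: "(\<lambda>\<omega>. G (\<omega> m)) \<in> borel_measurable (play_law q k \<sigma> \<tau>)" for m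
    by (rule measurable_compose[OF stage_measurable]) simp
  have int: "integrable (play_law q k \<sigma> \<tau>) (\<lambda>\<omega>. G (\<omega> m))" for m
    by (rule P.integrable_const_bound[where B=B]) (use B G_meas in auto)
  have bound: "norm (w m * G (\<omega> m)) \<le> w m * B" for m \<omega>
    using w(1) B by (simp add: abs_mult mult_left_mono)
  have "payoff g q \<theta> k \<sigma> \<tau> t = (\<integral>\<omega>. (\<Sum>m. w m * G (\<omega> m)) \<partial>play_law q k \<sigma> \<tau>)"
    unfolding payoff_def w_def G_def
    by (intro Bochner_Integration.integral_cong refl suminf_cong) auto
  also have "\<dots> = (\<Sum>m. \<integral>\<omega>. w m * G (\<omega> m) \<partial>play_law q k \<sigma> \<tau>)"
  proof (rule integral_suminf)
    show "integrable (play_law q k \<sigma> \<tau>) (\<lambda>\<omega>. w m * G (\<omega> m))" for m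
      using int by simp
    show "AE \<omega> in play_law q k \<sigma> \<tau>. summable (\<lambda>m. norm (w m * G (\<omega> m)))"
      by (intro AE_I2 summable_comparison_test'[OF summable_mult2[OF sw, of B], of 0])
        (use bound in auto)
    have "(\<integral>\<omega>. norm (w m * G (\<omega> m)) \<partial>play_law q k \<sigma> \<tau>) \<le> w m * B" for m
      using bound int by (intro P.integral_le_const) auto
    then show "summable (\<lambda>m. \<integral>\<omega>. norm (w m * G (\<omega> m)) \<partial>play_law q k \<sigma> \<tau>)"
      by (intro summable_comparison_test'[OF summable_mult2[OF sw, of B], of 0]) auto
  qed
  also have "\<dots> = (\<Sum>m. if enat m < clock \<theta> t
      then \<theta> m * (\<Sum>s\<in>UNIV. pmf (state_law q k X Y m) s * mix (X m s) (Y m s) (g s)) else 0)"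
  proof (rule suminf_cong)
    fix m
    show "(\<integral>\<omega>. w m * G (\<omega> m) \<partial>play_law q k \<sigma> \<tau>) = (if enat m < clock \<theta> t
      then \<theta> m * (\<Sum>s\<in>UNIV. pmf (state_law q k X Y m) s * mix (X m s) (Y m s) (g s)) else 0)"
    proof (cases "\<theta> m = 0")
      case False
      \<comment> \<open>A stage that contributes has positive weight, so weight remains at every
        stage up to it and \<open>distr_play_law\<close> applies; stages of weight 0 contribute
        nothing.\<close>
      have nz: "tail \<theta> n \<noteq> 0" if "n \<le> m" for n
        using False weight_le_tail[OF \<theta>, of m] tail_antimono[OF \<theta> that] evaluation_nonneg[OF \<theta>, of m]
        by linarith
      have "(\<integral>\<omega>. G (\<omega> m) \<partial>play_law q k \<sigma> \<tau>) =
          (\<integral>a. G a \<partial>distr (play_law q k \<sigma> \<tau>) ?N (\<lambda>\<omega>. \<omega> m))"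
        by (subst integral_distr[OF stage_measurable]) auto
      also have "\<dots> = measure_pmf.expectation (stage_law q k X Y m) G"
        by (subst distr_play_law[where X=X and Y=Y]) (use \<sigma> \<tau> nz in auto)
      finally show ?thesis
        by (simp add: w_def G_def expectation_stage_law)
    qed (simp add: w_def)
  qed
  finally show ?thesis .
qed

subsection \<open>Convergent Puiseux series as analytic germs\<close>

text \<open>The complex germ \<open>F\<close> lives in the uniformizing variable \<open>s\<close> with \<open>lam = s ^ M\<close>.\<close>

definition puiseux_germ :: "nat \<Rightarrow> (real \<Rightarrow> real) \<Rightarrow> bool" where
  "puiseux_germ M f \<longleftrightarrow> (\<exists>F. F analytic_on {0} \<and>
     (\<forall>\<^sub>F s in at_right 0. complex_of_real (f (s ^ M)) = F (complex_of_real s)))"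

lemma filterlim_power_at_right_0:
  assumes "M > 0"
  shows "filterlim (\<lambda>s::real. s ^ M) (at_right 0) (at_right 0)"
proof -
  have pos: "\<forall>\<^sub>F s::real in at_right 0. 0 < s ^ M"
    using eventually_at_right_less[of 0] by eventually_elim simp
  have "((\<lambda>s::real. s ^ M) \<longlongrightarrow> 0 ^ M) (at_right 0)"
    by (intro tendsto_intros)
  then show ?thesis
    using assms pos by (auto simp: filterlim_at zero_power elim!: eventually_mono)
qed

lemma filterlim_root_at_right_0:
  assumes "M > 0"
  shows "filterlim (root M) (at_right 0) (at_right 0)"
proof -
  have pos: "\<forall>\<^sub>F s in at_right 0. 0 < root M s"
    using eventually_at_right_less[of 0] by eventually_elim (use assms in simp)
  have "(root M \<longlongrightarrow> root M 0) (at_right 0)"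
    by (intro tendsto_real_root tendsto_ident_at)
  then show ?thesis
    using pos by (auto simp: filterlim_at elim!: eventually_mono)
qed

text \<open>Putting \<open>lam = s ^ N\<close> turns the Puiseux series into a power series in
  \<open>s\<close>. It converges at some \<open>s0 > 0\<close>, hence on the complex disc of radius
  \<open>s0\<close>.\<close>

lemma puiseux_germ_if_puiseux_near_0:
  assumes "puiseux_near_0 f"
  shows "\<exists>N>0. puiseux_germ N f"
proof -
  obtain N :: nat and a :: "nat \<Rightarrow> real" where N: "N \<ge> 1"
    and a: "\<forall>\<^sub>F lam in at_right 0. (\<lambda>r. a r * lam powr (real r / real N)) sums f lam"
    using assms unfolding puiseux_near_0_def by blast
  have "\<forall>\<^sub>F s in at_right 0. (\<lambda>r. a r * (s ^ N) powr (real r / real N)) sums f (s ^ N)"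
    using N by (intro eventually_compose_filterlim[OF a filterlim_power_at_right_0]) simp
  moreover have "\<forall>\<^sub>F s::real in at_right 0. 0 < s"
    by (rule eventually_at_right_less)
  ultimately have s: "\<forall>\<^sub>F s in at_right 0. 0 < s \<and> (\<lambda>r. a r * s ^ r) sums f (s ^ N)"
  proof eventually_elim
    case (elim s)
    then have "(s ^ N) powr (real r / real N) = s ^ r" for r
      using N by (simp add: powr_realpow[symmetric] powr_powr)
    then show ?case
      using elim by simp
  qed
  then obtain s0 where s0: "0 < s0" "summable (\<lambda>r. a r * s0 ^ r)"
    using eventually_happens[OF s] by (auto simp: sums_iff)
  define F where "F z = (\<Sum>r. complex_of_real (a r) * z ^ r)" for z
  have "summable (\<lambda>r. complex_of_real (a r * s0 ^ r))"
    using s0(2) by (rule summable_of_real)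
  then have "summable (\<lambda>r. complex_of_real (a r) * complex_of_real s0 ^ r)"
    by simp
  then have sum: "summable (\<lambda>r. complex_of_real (a r) * z ^ r)" if "norm z < s0" for z
    by (rule powser_inside) (use that s0(1) in simp)
  have "F analytic_on ball 0 s0"
    by (rule power_series_analytic[where a="\<lambda>r. complex_of_real (a r)"])
      (use sum in \<open>auto simp: F_def summable_sums\<close>)
  then have "F analytic_on {0}"
    by (rule analytic_on_subset) (use s0 in auto)
  moreover have "\<forall>\<^sub>F s in at_right 0. complex_of_real (f (s ^ N)) = F (complex_of_real s)"
    using s
  proof eventually_elim
    case (elim s)
    then have "(\<lambda>r. complex_of_real (a r * s ^ r)) sums complex_of_real (f (s ^ N))"
      by (simp only: sums_of_real_iff)
    then show ?case
      by (simp add: F_def sums_iff)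
  qed
  ultimately show ?thesis
    using N unfolding puiseux_germ_def by (intro exI[of _ N]) auto
qed

text \<open>Substituting \<open>s ^ d\<close> for \<open>s\<close> keeps the germ analytic; this
  brings finitely many series to a common root index.\<close>

lemma puiseux_germ_mult_index:
  assumes "puiseux_germ M f" and "d > 0"
  shows "puiseux_germ (M * d) f"
proof -
  obtain F where F: "F analytic_on {0}"
    and ev: "\<forall>\<^sub>F s in at_right 0. complex_of_real (f (s ^ M)) = F (complex_of_real s)"
    using assms(1) unfolding puiseux_germ_def by blast
  have "(F \<circ> (\<lambda>z. z ^ d)) analytic_on {0}"
    using F assms(2) by (intro analytic_on_compose analytic_intros) (auto simp: zero_power)
  moreover have "\<forall>\<^sub>F s in at_right 0. complex_of_real (f ((s ^ d) ^ M)) = F (complex_of_real (s ^ d))"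
    by (rule eventually_compose_filterlim[OF ev filterlim_power_at_right_0[OF assms(2)]])
  then have "\<forall>\<^sub>F s in at_right 0. complex_of_real (f (s ^ (M * d))) =
      (F \<circ> (\<lambda>z. z ^ d)) (complex_of_real s)"
    by eventually_elim (simp add: mult.commute[of M d] power_mult)
  ultimately show ?thesis
    unfolding puiseux_germ_def by blast
qed

lemma common_puiseux_germ:
  assumes "finite A" and "\<And>f. f \<in> A \<Longrightarrow> puiseux_near_0 f"
  shows "\<exists>M>0. \<forall>f\<in>A. puiseux_germ M f"
  using assms
proof (induction A)
  case (insert f A)
  then obtain M N where "M > 0" "\<forall>f\<in>A. puiseux_germ M f" "N > 0" "puiseux_germ N f"
    using puiseux_germ_if_puiseux_near_0[of f] by auto
  then have "\<forall>f\<in>insert f A. puiseux_germ (M * N) f"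
    using puiseux_germ_mult_index[of N f M] puiseux_germ_mult_index[of M _ N]
    by (auto simp: mult.commute)
  then show ?case
    using \<open>M > 0\<close> \<open>N > 0\<close> by (intro exI[of _ "M * N"]) auto
qed auto

lemma puiseux_germ_const: "puiseux_germ M (\<lambda>lam. c)"
  unfolding puiseux_germ_def by (intro exI[of _ "\<lambda>z. of_real c"]) auto

lemma puiseux_germ_ident: "puiseux_germ M (\<lambda>lam. lam)"
  unfolding puiseux_germ_def by (intro exI[of _ "\<lambda>z. z ^ M"]) (auto intro: analytic_intros)

lemma puiseux_germ_add:
  assumes "puiseux_germ M f" and "puiseux_germ M h"
  shows "puiseux_germ M (\<lambda>lam. f lam + h lam)"
proof -
  obtain F H where F: "F analytic_on {0}" "H analytic_on {0}"
    and ev: "\<forall>\<^sub>F s in at_right 0. complex_of_real (f (s ^ M)) = F (complex_of_real s)"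
      "\<forall>\<^sub>F s in at_right 0. complex_of_real (h (s ^ M)) = H (complex_of_real s)"
    using assms unfolding puiseux_germ_def by blast
  have "\<forall>\<^sub>F s in at_right 0. complex_of_real (f (s ^ M) + h (s ^ M)) =
      F (complex_of_real s) + H (complex_of_real s)"
    using ev by eventually_elim simp
  then show ?thesis
    unfolding puiseux_germ_def by (intro exI[of _ "\<lambda>z. F z + H z"]) (auto intro: F analytic_intros)
qed

lemma puiseux_germ_mult:
  assumes "puiseux_germ M f" and "puiseux_germ M h"
  shows "puiseux_germ M (\<lambda>lam. f lam * h lam)"
proof -
  obtain F H where F: "F analytic_on {0}" "H analytic_on {0}"
    and ev: "\<forall>\<^sub>F s in at_right 0. complex_of_real (f (s ^ M)) = F (complex_of_real s)"
      "\<forall>\<^sub>F s in at_right 0. complex_of_real (h (s ^ M)) = H (complex_of_real s)"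
    using assms unfolding puiseux_germ_def by blast
  have "\<forall>\<^sub>F s in at_right 0. complex_of_real (f (s ^ M) * h (s ^ M)) =
      F (complex_of_real s) * H (complex_of_real s)"
    using ev by eventually_elim simp
  then show ?thesis
    unfolding puiseux_germ_def by (intro exI[of _ "\<lambda>z. F z * H z"]) (auto intro: F analytic_intros)
qed

lemma puiseux_germ_diff:
  assumes "puiseux_germ M f" and "puiseux_germ M h"
  shows "puiseux_germ M (\<lambda>lam. f lam - h lam)"
  using puiseux_germ_add[OF assms(1) puiseux_germ_mult[OF puiseux_germ_const[of M "-1"] assms(2)]]
  by simp

lemma puiseux_germ_sum:
  assumes "\<And>a. a \<in> A \<Longrightarrow> puiseux_germ M (f a)"
  shows "puiseux_germ M (\<lambda>lam. \<Sum>a\<in>A. f a lam)"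
  using assms
  by (induction A rule: infinite_finite_induct) (auto intro: puiseux_germ_const puiseux_germ_add)

text \<open>A quotient has at most a pole at 0, and boundedness along the positive axis excludes the pole.\<close>

lemma puiseux_germ_divide_bounded:
  assumes "M > 0" and "puiseux_germ M f" and "puiseux_germ M h"
    and bound: "\<forall>\<^sub>F lam in at_right 0. \<bar>f lam / h lam\<bar> \<le> B"
  shows "puiseux_germ M (\<lambda>lam. f lam / h lam)"
proof -
  obtain F H where F: "F analytic_on {0}" "H analytic_on {0}"
    and ev: "\<forall>\<^sub>F s in at_right 0. complex_of_real (f (s ^ M)) = F (complex_of_real s)"
      "\<forall>\<^sub>F s in at_right 0. complex_of_real (h (s ^ M)) = H (complex_of_real s)"
    using assms(2,3) unfolding puiseux_germ_def by blast
  define R where "R z = F z / H z" for z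
  have "R meromorphic_on {0}"
    unfolding R_def
    by (intro meromorphic_intros analytic_on_imp_meromorphic_on F)
  then have iso: "isolated_singularity_at R 0" and ne: "not_essential R 0"
    by (auto simp: meromorphic_at_iff)
  have to0: "filterlim complex_of_real (at 0) (at_right 0)"
    by (auto simp: filterlim_at intro!: tendsto_eq_intros eventually_at_rightI[of 0 1])
  have eq: "\<forall>\<^sub>F s in at_right 0. complex_of_real (f (s ^ M) / h (s ^ M)) = R (complex_of_real s)"
    using ev by eventually_elim (simp add: R_def)
  have "\<not> is_pole R 0"
  proof
    assume "is_pole R 0"
    then have "filterlim R at_infinity (at 0)"
      by (simp add: is_pole_def)
    then have "filterlim (\<lambda>s. R (complex_of_real s)) at_infinity (at_right 0)"
      by (rule filterlim_compose[OF _ to0])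
    then have "\<forall>\<^sub>F s in at_right 0. B + 1 \<le> norm (R (complex_of_real s))"
      unfolding filterlim_at_infinity_conv_norm_at_top filterlim_at_top by blast
    moreover have "\<forall>\<^sub>F s in at_right 0. \<bar>f (s ^ M) / h (s ^ M)\<bar> \<le> B"
      by (rule eventually_compose_filterlim[OF bound filterlim_power_at_right_0[OF assms(1)]])
    ultimately have "\<forall>\<^sub>F s::real in at_right 0. False"
      using eq
    proof eventually_elim
      case (elim s)
      have "norm (R (complex_of_real s)) = \<bar>f (s ^ M) / h (s ^ M)\<bar>"
        unfolding elim(3)[symmetric] by (rule norm_of_real)
      then show False
        using elim by linarith
    qed
    then show False
      by simp
  qed
  then obtain c where "R \<midarrow>0\<rightarrow> c"
    using ne by (auto simp: not_essential_def)
  then have "remove_sings R analytic_on {0}"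
    using iso by (rule remove_sings_analytic_at[rotated])
  moreover have "\<forall>\<^sub>F s in at_right 0. complex_of_real (f (s ^ M) / h (s ^ M)) =
      remove_sings R (complex_of_real s)"
    using eq eventually_compose_filterlim[OF eventually_remove_sings_eq_at[OF iso] to0]
    by eventually_elim simp
  ultimately show ?thesis
    unfolding puiseux_germ_def by blast
qed

text \<open>With \<open>s = root M lam\<close> and \<open>f lam = G s\<close>, the chain rule gives
  \<open>lam * f' lam = s * G' s / M\<close>. This tends to 0 even if \<open>f'\<close> itself is
  unbounded near 0.\<close>

lemma puiseux_germ_regular:
  assumes "M > 0" and "puiseux_germ M f"
  obtains L f' where "(f \<longlongrightarrow> L) (at_right 0)"
    and "\<forall>\<^sub>F lam in at_right 0. (f has_real_derivative f' lam) (at lam)"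
    and "((\<lambda>lam. lam * f' lam) \<longlongrightarrow> 0) (at_right 0)"
proof -
  obtain F where F: "F analytic_on {0}"
    and ev: "\<forall>\<^sub>F s in at_right 0. complex_of_real (f (s ^ M)) = F (complex_of_real s)"
    using assms(2) unfolding puiseux_germ_def by blast
  define G where "G s = Re (F (complex_of_real s))" for s
  define f' where "f' lam = Re (deriv F (complex_of_real (root M lam))) *
      inverse (real M * root M lam ^ (M - Suc 0))" for lam
  have "\<forall>\<^sub>F s in at_right 0. f (s ^ M) = G s"
    using ev by eventually_elim (metis G_def Re_complex_of_real)
  from eventually_compose_filterlim[OF this filterlim_root_at_right_0[OF assms(1)]]
    eventually_at_right_less[of 0]
  have fG: "\<forall>\<^sub>F lam in at_right 0. f lam = G (root M lam)"
    by eventually_elim (use assms(1) in simp)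
  have to0: "((\<lambda>lam. complex_of_real (root M lam)) \<longlongrightarrow> 0) (at_right 0)"
    using filterlim_root_at_right_0[OF assms(1)]
    by (auto simp: filterlim_at intro!: tendsto_eq_intros)
  have cF: "isCont F 0" and cF': "isCont (deriv F) 0"
    using F analytic_deriv[OF F] by (auto intro: analytic_at_imp_isCont)
  have "((\<lambda>lam. G (root M lam)) \<longlongrightarrow> Re (F 0)) (at_right 0)"
    unfolding G_def by (intro tendsto_Re isCont_tendsto_compose[OF cF to0])
  then have lim: "(f \<longlongrightarrow> Re (F 0)) (at_right 0)"
    by (rule Lim_transform_eventually) (use fG in \<open>eventually_elim, simp\<close>)
  have "\<forall>\<^sub>F lam in at_right 0. (root M lam * Re (deriv F (complex_of_real (root M lam))) / real M) = lam * f' lam"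
    using eventually_at_right_less[of 0]
  proof eventually_elim
    case (elim lam)
    have s: "root M lam > 0"
      using elim assms(1) by simp
    have "root M lam * root M lam ^ (M - Suc 0) = root M lam ^ M"
      using assms(1) by (cases M) simp_all
    also have "\<dots> = lam"
      using elim assms(1) by (simp add: real_root_pow_pos2)
    finally have "root M lam * root M lam ^ (M - Suc 0) = lam" .
    then have "lam * f' lam = (root M lam * root M lam ^ (M - Suc 0)) * f' lam"
      by simp
    also have "\<dots> = root M lam * Re (deriv F (complex_of_real (root M lam))) / real M"
      unfolding f'_def using s by (simp add: divide_simps)
    finally show ?case
      by (rule sym)
  qed
  moreover have "((\<lambda>lam. root M lam * Re (deriv F (complex_of_real (root M lam))) / real M)
      \<longlongrightarrow> 0 * Re (deriv F 0) / real M) (at_right 0)"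
    using assms(1) filterlim_root_at_right_0[OF assms(1)]
    by (intro tendsto_intros tendsto_Re isCont_tendsto_compose[OF cF' to0]) (auto simp: filterlim_at)
  ultimately have lim': "((\<lambda>lam. lam * f' lam) \<longlongrightarrow> 0) (at_right 0)"
    by (auto intro: Lim_transform_eventually)
  obtain r where r: "r > 0" "F holomorphic_on ball 0 r"
    using F by (auto simp: analytic_on_def)
  \<comment> \<open>Transferring the derivative to \<open>f\<close> needs the identity on a
    neighbourhood of \<open>lam\<close>, hence an explicit interval.\<close>
  obtain b where b: "b > 0" "\<And>lam. 0 < lam \<Longrightarrow> lam < b \<Longrightarrow> f lam = G (root M lam)"
    using fG by (auto simp: eventually_at_right_field)
  have "\<forall>\<^sub>F lam in at_right 0. lam < b"
    using b(1) by (auto simp: eventually_at_right_field)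
  moreover have "\<forall>\<^sub>F lam in at_right 0. root M lam < r"
    using order_tendstoD(2)[of "root M" 0 "at_right 0" r] filterlim_root_at_right_0[OF assms(1)] r(1)
    by (auto simp: filterlim_at)
  ultimately have "\<forall>\<^sub>F lam in at_right 0. (f has_real_derivative f' lam) (at lam)"
    using eventually_at_right_less[of 0]
  proof eventually_elim
    case (elim lam)
    have s: "0 < root M lam"
      using elim assms(1) by simp
    have "(F has_field_derivative deriv F (complex_of_real (root M lam))) (at (complex_of_real (root M lam)))"
      using r elim s by (intro holomorphic_derivI[where S="ball 0 r"]) auto
    then have "((\<lambda>s. F (complex_of_real s)) has_vector_derivative deriv F (complex_of_real (root M lam)))
        (at (root M lam))"
      by (rule has_vector_derivative_real_field)
    then have "(G has_vector_derivative Re (deriv F (complex_of_real (root M lam)))) (at (root M lam))"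
      unfolding G_def by (rule bounded_linear.has_vector_derivative[OF bounded_linear_Re])
    then have "(G has_real_derivative Re (deriv F (complex_of_real (root M lam)))) (at (root M lam))"
      by (simp add: has_real_derivative_iff_has_vector_derivative)
    from DERIV_chain2[OF this DERIV_real_root[OF assms(1) elim(3)]]
    have "((\<lambda>lam. G (root M lam)) has_real_derivative f' lam) (at lam)"
      by (simp add: f'_def)
    then show ?case
      by (rule has_field_derivative_transform_within_open[where S="{0<..<b}"]) (use elim b in auto)
  qed
  then show ?thesis
    using that lim lim' by blast
qed

text \<open>The action set is finite, so the entrywise limits are nonnegative and sum to 1. Hence
  \<open>embed_pmf\<close> in \<open>extend_at_0\<close> really yields a distribution with these
  entries.\<close>

lemma pmf_extend_at_0:
  fixes x :: "real \<Rightarrow> 'k \<Rightarrow> 'a::finite pmf"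
  assumes "\<And>a. \<exists>L. ((\<lambda>lam. pmf (x lam s) a) \<longlongrightarrow> L) (at_right 0)"
  shows "((\<lambda>lam. pmf (x lam s) a) \<longlongrightarrow> pmf (extend_at_0 x 0 s) a) (at_right 0)"
proof -
  define L where "L a = Lim (at_right 0) (\<lambda>lam. pmf (x lam s) a)" for a
  have L: "((\<lambda>lam. pmf (x lam s) a) \<longlongrightarrow> L a) (at_right 0)" for a
    using assms[of a] unfolding L_def by (auto simp: tendsto_Lim)
  have nonneg: "0 \<le> L a" for a
    by (rule tendsto_lowerbound[OF L]) auto
  have "((\<lambda>lam. \<Sum>a\<in>UNIV. pmf (x lam s) a) \<longlongrightarrow> (\<Sum>a\<in>UNIV. L a)) (at_right 0)"
    by (intro tendsto_sum L)
  then have "(\<Sum>a\<in>UNIV. L a) = 1"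
    by (simp add: sum_pmf_eq_1 tendsto_const_iff)
  then have "(\<integral>\<^sup>+a. ennreal (L a) \<partial>count_space UNIV) = 1"
    by (simp add: nn_integral_count_space_finite sum_ennreal nonneg)
  then have "pmf (embed_pmf L) a = L a"
    using nonneg by (intro pmf_embed_pmf) auto
  then show ?thesis
    using L[of a] by (simp add: extend_at_0_def L_def[abs_def])
qed

lemma puiseux_germ_mix:
  assumes "\<And>i. puiseux_germ M (\<lambda>lam. pmf (x lam) i)" and "\<And>j. puiseux_germ M (\<lambda>lam. pmf (y lam) j)"
  shows "puiseux_germ M (\<lambda>lam. mix (x lam) (y lam) f)"
  unfolding mix_def
  by (intro puiseux_germ_sum puiseux_germ_mult puiseux_germ_const assms)

subsection \<open>Absorbing games\<close>

lemma evaluation_discounted: "0 < lam \<Longrightarrow> lam \<le> 1 \<Longrightarrow> evaluation (discounted lam)"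
  using sums_mult[OF geometric_sums[of "1 - lam"], of lam]
  by (auto simp: evaluation_def discounted_def[abs_def])

definition leave :: "('k \<Rightarrow> 'i \<Rightarrow> 'j \<Rightarrow> 'k pmf) \<Rightarrow> 'k \<Rightarrow> 'i \<Rightarrow> 'j \<Rightarrow> real" where
  "leave q k i j = 1 - pmf (q k i j) k"

text \<open>The contribution of the event of leaving \<open>k\<close> to the mean of
  \<open>w\<close>, not conditioned on that event. It thus enters recursions additively and makes
  sense when leaving has probability 0.\<close>

definition exit_reward ::
  "('k::finite \<Rightarrow> 'i \<Rightarrow> 'j \<Rightarrow> 'k pmf) \<Rightarrow> 'k \<Rightarrow> ('k \<Rightarrow> real) \<Rightarrow> 'i \<Rightarrow> 'j \<Rightarrow> real" where
  "exit_reward q k w i j = (\<Sum>l\<in>-{k}. pmf (q k i j) l * w l)"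

lemma leave_nonneg: "0 \<le> leave q k i j"
  by (simp add: leave_def pmf_le_1)

lemma leave_le_1: "leave q k i j \<le> 1"
  by (simp add: leave_def)

lemma exit_reward_abs_le:
  assumes "\<And>l. \<bar>w l\<bar> \<le> B"
  shows "\<bar>exit_reward q k w i j\<bar> \<le> B * leave q k i j"
proof -
  have "(\<Sum>l\<in>UNIV. pmf (q k i j) l) = 1"
    by (simp add: sum_pmf_eq_1)
  then have leave: "leave q k i j = (\<Sum>l\<in>-{k}. pmf (q k i j) l)"
    by (subst (asm) sum.remove[of _ k]) (simp_all add: leave_def Compl_eq_Diff_UNIV)
  have "\<bar>exit_reward q k w i j\<bar> \<le> (\<Sum>l\<in>-{k}. \<bar>pmf (q k i j) l * w l\<bar>)"
    unfolding exit_reward_def by (rule sum_abs)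
  also have "\<dots> \<le> (\<Sum>l\<in>-{k}. pmf (q k i j) l * B)"
    by (intro sum_mono) (simp add: abs_mult assms mult_left_mono)
  also have "\<dots> = B * leave q k i j"
    by (simp add: leave sum_distrib_left mult.commute)
  finally show ?thesis .
qed

lemma absorbing_return:
  assumes "absorbing_game q k" and "l \<noteq> k"
  shows "q l i j = return_pmf l"
proof -
  have 1: "measure_pmf.prob (q l i j) {l} = 1"
    using assms by (simp add: absorbing_game_def measure_pmf_single)
  have "set_pmf (q l i j) \<subseteq> {l}"
    using 1 by (metis AE_measure_pmf_iff measure_pmf.prob_eq_1 sets_measure_pmf UNIV_I
        sets_UNIV subsetI)
  then show ?thesis
    by (simp add: set_pmf_subset_singleton)
qed

lemma state_law_absorbed:
  assumes "absorbing_game q k" and "l \<noteq> k"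
  shows "state_law q l X Y m = return_pmf l"
  by (induction m) (simp_all add: absorbing_return[OF assms] bind_return_pmf case_prod_unfold)

text \<open>No other state leads to \<open>k\<close>, so the only mass there is what has never
  left.\<close>

lemma live_Suc:
  fixes q :: "'k::finite \<Rightarrow> 'i::finite \<Rightarrow> 'j::finite \<Rightarrow> 'k pmf"
  assumes "absorbing_game q k"
  shows "pmf (state_law q k X Y (Suc m)) k =
    pmf (state_law q k X Y m) k * (1 - mix (X m k) (Y m k) (leave q k))"
proof -
  have "mix a b (\<lambda>i j. pmf (q s i j) k) = 0" if "s \<noteq> k" for s a b
    using absorbing_return[OF assms that] that by simp
  then have "pmf (state_law q k X Y (Suc m)) k =
      pmf (state_law q k X Y m) k * mix (X m k) (Y m k) (\<lambda>i j. pmf (q k i j) k)"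
    unfolding pmf_state_law_Suc by (subst sum.remove[of _ k]) auto
  moreover have "mix (X m k) (Y m k) (leave q k) = 1 - mix (X m k) (Y m k) (\<lambda>i j. pmf (q k i j) k)"
    unfolding leave_def[abs_def] by (subst mix_diff) simp
  ultimately show ?thesis
    by simp
qed

text \<open>Mass at an absorbing state stays, and the only inflow comes from
  \<open>k\<close>.\<close>

lemma absorbed_Suc:
  fixes q :: "'k::finite \<Rightarrow> 'i::finite \<Rightarrow> 'j::finite \<Rightarrow> 'k pmf"
  assumes "absorbing_game q k"
  shows "(\<Sum>l\<in>-{k}. pmf (state_law q k X Y (Suc m)) l * w l) =
    (\<Sum>l\<in>-{k}. pmf (state_law q k X Y m) l * w l) +
    pmf (state_law q k X Y m) k * mix (X m k) (Y m k) (exit_reward q k w)"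
proof -
  have step: "pmf (state_law q k X Y (Suc m)) l = pmf (state_law q k X Y m) l +
      pmf (state_law q k X Y m) k * mix (X m k) (Y m k) (\<lambda>i j. pmf (q k i j) l)" if "l \<noteq> k" for l
  proof -
    have "mix a b (\<lambda>i j. pmf (q s i j) l) = (if s = l then 1 else 0)" if "s \<noteq> k" for s a b
      using absorbing_return[OF assms that] that by (simp add: indicator_def)
    then have "(\<Sum>s\<in>-{k}. pmf (state_law q k X Y m) s * mix (X m s) (Y m s) (\<lambda>i j. pmf (q s i j) l))
        = (\<Sum>s\<in>-{k}. if s = l then pmf (state_law q k X Y m) s else 0)"
      by (intro sum.cong) auto
    also have "\<dots> = pmf (state_law q k X Y m) l"
      using that by (simp add: sum.delta)
    finally show ?thesis
      unfolding pmf_state_law_Suc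
      by (subst sum.remove[of _ k]) (simp_all add: Compl_eq_Diff_UNIV)
  qed
  have "mix (X m k) (Y m k) (exit_reward q k w) =
      (\<Sum>l\<in>-{k}. mix (X m k) (Y m k) (\<lambda>i j. pmf (q k i j) l) * w l)"
    unfolding exit_reward_def[abs_def] mix_sum
    by (simp add: mult.commute[of _ "w _"] mix_cmult)
  moreover have "(\<Sum>l\<in>-{k}. pmf (state_law q k X Y (Suc m)) l * w l) =
      (\<Sum>l\<in>-{k}. pmf (state_law q k X Y m) l * w l +
        pmf (state_law q k X Y m) k * (mix (X m k) (Y m k) (\<lambda>i j. pmf (q k i j) l) * w l))"
    by (intro sum.cong) (simp_all add: step algebra_simps del: state_law.simps)
  ultimately show ?thesis
    by (simp add: sum.distrib sum_distrib_left del: state_law.simps)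
qed

lemma payoff_discounted_absorbed:
  fixes q :: "'k::finite \<Rightarrow> 'i::finite \<Rightarrow> 'j::finite \<Rightarrow> 'k pmf"
  assumes "absorbing_game q k" and "l \<noteq> k" and lam: "0 < lam" "lam \<le> 1"
  shows "payoff g q (discounted lam) l (stationary x) (stationary y) 1 = mix (x l) (y l) (g l)"
proof -
  have ev: "evaluation (discounted lam)"
    using lam by (rule evaluation_discounted)
  have "(\<Sum>s\<in>UNIV. pmf (return_pmf l) s * mix (x s) (y s) (g s)) = mix (x l) (y l) (g l)"
    by (subst sum.remove[of _ l]) auto
  then have "payoff g q (discounted lam) l (stationary x) (stationary y) 1 =
      (\<Sum>m. if enat m < clock (discounted lam) 1
        then discounted lam m * mix (x l) (y l) (g l) else 0)"
    by (subst payoff_markov[OF ev, where X="\<lambda>_. x" and Y="\<lambda>_. y"])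
      (simp_all add: stationary_def state_law_absorbed[OF assms(1,2)] cong: if_cong)
  also have "\<dots> = (\<Sum>m. discounted lam m * mix (x l) (y l) (g l))"
    using less_clock_one[OF ev] by (intro suminf_cong) auto
  also have "\<dots> = mix (x l) (y l) (g l)"
    using ev suminf_mult2[OF evaluation_summable[OF ev], of "mix (x l) (y l) (g l)"]
    by (simp add: evaluation_def sums_iff)
  finally show ?thesis .
qed

text \<open>The payoff is \<open>u * A + B\<close>, with \<open>A\<close> the discounted time spent
  at \<open>k\<close> and \<open>B\<close> the discounted reward after absorption. Shifting both
  series by one stage gives linear equations for \<open>A\<close> and \<open>B\<close>; the result
  is stated with the denominator cleared.\<close>

lemma payoff_discounted_live:
  fixes q :: "'k::finite \<Rightarrow> 'i::finite \<Rightarrow> 'j::finite \<Rightarrow> 'k pmf"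
  assumes abs: "absorbing_game q k" and lam: "0 < lam" "lam \<le> 1"
    and w: "\<And>l. l \<noteq> k \<Longrightarrow> mix (x l) (y l) (g l) = w l"
  shows "payoff g q (discounted lam) k (stationary x) (stationary y) 1 *
      (lam + (1 - lam) * mix (x k) (y k) (leave q k)) =
    lam * mix (x k) (y k) (g k) + (1 - lam) * mix (x k) (y k) (exit_reward q k w)"
proof -
  define d where "d = discounted lam"
  have ev: "evaluation d"
    unfolding d_def using lam by (rule evaluation_discounted)
  define u p c where "u = mix (x k) (y k) (g k)" and "p = mix (x k) (y k) (leave q k)"
    and "c = mix (x k) (y k) (exit_reward q k w)"
  define S where "S m = pmf (state_law q k (\<lambda>_. x) (\<lambda>_. y) m) k" for m
  define W where "W m = (\<Sum>l\<in>-{k}. pmf (state_law q k (\<lambda>_. x) (\<lambda>_. y) m) l * w l)" for m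
  have S: "S 0 = 1" "S (Suc m) = S m * (1 - p)" for m
    unfolding S_def p_def using live_Suc[OF abs] by (simp_all del: state_law.simps(2))
  have W: "W 0 = 0" "W (Suc m) = W m + S m * c" for m
    unfolding W_def S_def c_def using absorbed_Suc[OF abs]
    by (simp_all del: state_law.simps(2) add: indicator_def)
  have d: "d (Suc m) = (1 - lam) * d m" for m
    by (simp add: d_def discounted_def)
  have sd: "summable d" and dpos: "0 \<le> d m" for m
    using evaluation_summable[OF ev] evaluation_nonneg[OF ev] by auto
  have sS: "summable (\<lambda>m. d m * S m)"
    by (rule summable_comparison_test'[OF sd, of 0])
      (use dpos in \<open>auto simp: S_def abs_mult pmf_le_1 mult_left_le\<close>)
  have Wb: "\<bar>W m\<bar> \<le> (\<Sum>l\<in>-{k}. \<bar>w l\<bar>)" for m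
    unfolding W_def
    by (intro order_trans[OF sum_abs] sum_mono) (simp add: abs_mult pmf_le_1 mult_left_le_one_le)
  have sW: "summable (\<lambda>m. d m * W m)"
    by (rule summable_comparison_test'[OF summable_mult2[OF sd, of "\<Sum>l\<in>-{k}. \<bar>w l\<bar>"], of 0])
      (use dpos Wb in \<open>auto simp: abs_mult intro!: mult_left_mono\<close>)
  define A B where "A = (\<Sum>m. d m * S m)" and "B = (\<Sum>m. d m * W m)"
  \<comment> \<open>The first term of \<open>A\<close> is \<open>lam\<close>; each later term is
    \<open>(1 - lam) * (1 - p)\<close> times its predecessor.\<close>
  have "A - lam = (\<Sum>m. d (Suc m) * S (Suc m))"
    using suminf_split_head[OF sS] S(1) by (simp add: A_def d_def discounted_def)
  also have "\<dots> = (\<Sum>m. ((1 - lam) * (1 - p)) * (d m * S m))"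
    by (simp add: S d algebra_simps)
  also have "\<dots> = (1 - lam) * (1 - p) * A"
    unfolding A_def by (rule suminf_mult[OF sS])
  finally have A: "A * (lam + (1 - lam) * p) = lam"
    by (simp add: algebra_simps)
  have "B = (\<Sum>m. d (Suc m) * W (Suc m))"
    using suminf_split_head[OF sW] W(1) by (simp add: B_def)
  also have "\<dots> = (\<Sum>m. (1 - lam) * (d m * W m + c * (d m * S m)))"
    by (simp add: W d algebra_simps)
  also have "\<dots> = (1 - lam) * (B + c * A)"
    unfolding A_def B_def
    by (subst suminf_mult) (use sS sW in \<open>auto intro!: summable_add summable_mult
        simp: suminf_add[symmetric] suminf_mult\<close>)
  finally have B0: "B = (1 - lam) * (B + c * A)" .
  have B: "lam * B = (1 - lam) * c * A"
    using B0 by (simp add: algebra_simps)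
  \<comment> \<open>Inserting the identity for \<open>A\<close> leaves a common factor
    \<open>lam\<close>, which cancels because \<open>lam > 0\<close>.\<close>
  have "lam * (B * (lam + (1 - lam) * p)) = (lam * B) * (lam + (1 - lam) * p)"
    by simp
  also have "\<dots> = (1 - lam) * c * (A * (lam + (1 - lam) * p))"
    unfolding B by simp
  also have "\<dots> = lam * ((1 - lam) * c)"
    unfolding A by simp
  finally have B': "B * (lam + (1 - lam) * p) = (1 - lam) * c"
    using lam by simp
  have stage: "(\<Sum>s\<in>UNIV. pmf (state_law q k (\<lambda>_. x) (\<lambda>_. y) m) s * mix (x s) (y s) (g s)) =
      S m * u + W m" for m
    unfolding S_def W_def u_def
    by (subst sum.remove[of _ k]) (auto simp: w Compl_eq_Diff_UNIV intro!: sum.cong)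
  have "payoff g q d k (stationary x) (stationary y) 1 =
      (\<Sum>m. if enat m < clock d 1 then d m * (S m * u + W m) else 0)"
    by (subst payoff_markov[OF ev, where X="\<lambda>_. x" and Y="\<lambda>_. y"])
      (simp_all add: stationary_def stage cong: if_cong)
  also have "\<dots> = (\<Sum>m. u * (d m * S m) + d m * W m)"
  proof (rule suminf_cong)
    show "(if enat m < clock d 1 then d m * (S m * u + W m) else 0) = u * (d m * S m) + d m * W m" for m
      using less_clock_one[OF ev, of m] by (cases "d m = 0") (simp_all add: algebra_simps)
  qed
  also have "\<dots> = u * A + B"
    unfolding A_def B_def using sS sW
    by (subst suminf_add[symmetric]) (auto simp: suminf_mult intro: summable_mult)
  finally show ?thesis
    unfolding d_def[symmetric] u_def[symmetric] p_def[symmetric] c_def[symmetric]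
    using A B' by (simp add: distrib_right mult.assoc)
qed

subsection \<open>The envelope identity and the deviation estimate\<close>

text \<open>Here \<open>u mu\<close>, \<open>p mu\<close>, \<open>c mu\<close> are meant for the
  pair formed by the strategy of Player 1 at rate \<open>lam\<close> and that of Player 2 at rate
  \<open>mu\<close>. Subtracting \<open>upper\<close> from \<open>lower\<close> gives a quantity
  with factor \<open>lam - mu\<close>, whose cofactor changes sign at \<open>lam\<close> and so has
  limit 0 there. Only \<open>v\<close> has to be differentiable; \<open>u\<close>, \<open>p\<close>
  and \<open>c\<close> need just continuity.\<close>

lemma envelope_identity:
  fixes u p c :: "real \<Rightarrow> real" and v :: "real \<Rightarrow> real"
  assumes v: "(v has_real_derivative v') (at lam)"
    and lower: "\<forall>\<^sub>F mu in at lam. 0 \<le> lam * (u mu - v lam) + (1 - lam) * (c mu - v lam * p mu)"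
    and upper: "\<forall>\<^sub>F mu in at lam. mu * (u mu - v mu) + (1 - mu) * (c mu - v mu * p mu) \<le> 0"
    and cont: "isCont u lam" "isCont p lam" "isCont c lam"
  shows "(u lam - v lam) - (c lam - v lam * p lam) = v' * (lam + (1 - lam) * p lam)"
proof -
  define Q where "Q f mu = (f mu - f lam) / (mu - lam)" for f :: "real \<Rightarrow> real" and mu
  \<comment> \<open>The left side of \<open>lower\<close> minus that of \<open>upper\<close>,
    divided by \<open>lam - mu\<close>.\<close>
  define \<phi> where "\<phi> mu = u mu - c mu - Q (\<lambda>mu. mu * v mu) mu - p mu * Q (\<lambda>mu. (1 - mu) * v mu) mu"
    for mu
  have "((\<lambda>mu. mu * v mu) has_real_derivative v lam + lam * v') (at lam)"
    using v by (auto intro!: derivative_eq_intros)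
  then have q1: "(Q (\<lambda>mu. mu * v mu) \<longlongrightarrow> v lam + lam * v') (at lam)"
    by (simp add: has_field_derivative_iff Q_def[abs_def])
  have "((\<lambda>mu. (1 - mu) * v mu) has_real_derivative (1 - lam) * v' - v lam) (at lam)"
    using v by (auto intro!: derivative_eq_intros)
  then have q2: "(Q (\<lambda>mu. (1 - mu) * v mu) \<longlongrightarrow> (1 - lam) * v' - v lam) (at lam)"
    by (simp add: has_field_derivative_iff Q_def[abs_def])
  let ?L = "u lam - c lam - (v lam + lam * v') - p lam * ((1 - lam) * v' - v lam)"
  have lim: "(\<phi> \<longlongrightarrow> ?L) (at lam)"
    unfolding \<phi>_def using cont by (intro tendsto_intros q1 q2) (simp_all add: isCont_def)
  have "\<forall>\<^sub>F mu in at lam. mu \<noteq> lam"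
    by (simp add: eventually_at_filter)
  then have key: "\<forall>\<^sub>F mu in at lam. mu \<noteq> lam \<and> 0 \<le> (lam - mu) * \<phi> mu"
    using lower upper
  proof eventually_elim
    case (elim mu)
    have e: "(lam - mu) * Q f mu = f lam - f mu" for f
      using elim(1) by (simp add: Q_def field_simps)
    have "(lam - mu) * \<phi> mu = (lam - mu) * (u mu - c mu) - (lam - mu) * Q (\<lambda>mu. mu * v mu) mu
        - p mu * ((lam - mu) * Q (\<lambda>mu. (1 - mu) * v mu) mu)"
      unfolding \<phi>_def by (simp only: right_diff_distrib mult.left_commute)
    also have "\<dots> = (lam - mu) * (u mu - c mu) - (lam * v lam - mu * v mu)
        - p mu * ((1 - lam) * v lam - (1 - mu) * v mu)"
      by (simp only: e)
    also have "\<dots> = (lam * (u mu - v lam) + (1 - lam) * (c mu - v lam * p mu))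
        - (mu * (u mu - v mu) + (1 - mu) * (c mu - v mu * p mu))"
      by (simp add: algebra_simps)
    finally show ?case
      using elim by simp
  qed
  have left: "\<forall>\<^sub>F mu in at_left lam. mu < lam"
    by (simp add: eventually_at_filter)
  have "\<forall>\<^sub>F mu in at_left lam. 0 \<le> \<phi> mu"
    using filter_leD[OF at_le[OF subset_UNIV] key] left
    by eventually_elim (simp add: zero_le_mult_iff)
  then have 1: "0 \<le> ?L"
    using tendsto_lowerbound[OF filterlim_mono[OF lim order_refl at_le[OF subset_UNIV]]] by force
  have "\<forall>\<^sub>F mu in at_right lam. \<phi> mu \<le> 0"
    using filter_leD[OF at_le[OF subset_UNIV] key] eventually_at_right_less[of lam]
    by eventually_elim (simp add: zero_le_mult_iff)
  then have 2: "?L \<le> 0"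
    using tendsto_upperbound[OF filterlim_mono[OF lim order_refl at_le[OF subset_UNIV]]] by force
  from 1 2 show ?thesis
    by (simp add: algebra_simps)
qed

text \<open>\<open>bellman\<close> and \<open>envelope\<close> are two linear equations in
  \<open>u - v\<close> and \<open>c - v * p\<close>. Their solution is
  \<open>u - v = (1 - lam) * v' * K\<close> and \<open>c - v * p = - lam * v' * K\<close> with
  \<open>K = lam + (1 - lam) * p\<close>. Half of \<open>\<eta>\<close> pays for the smallness of
  \<open>lam * v'\<close>, half for replacing \<open>v\<close> by \<open>L\<close>.\<close>

lemma balance_estimate:
  fixes u p c v v' :: "real \<Rightarrow> real"
  assumes lim: "(v \<longlongrightarrow> L) (at_right 0)" "((\<lambda>lam. lam * v' lam) \<longlongrightarrow> 0) (at_right 0)"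
    and p: "\<And>lam. 0 \<le> p lam"
    and bellman: "\<forall>\<^sub>F lam in at_right 0. v lam * (lam + (1 - lam) * p lam) = lam * u lam + (1 - lam) * c lam"
    and envelope: "\<forall>\<^sub>F lam in at_right 0. (u lam - v lam) - (c lam - v lam * p lam) =
        v' lam * (lam + (1 - lam) * p lam)"
    and \<eta>: "0 < \<eta>"
  shows "\<forall>\<^sub>F lam in at_right 0. lam * \<bar>u lam - L\<bar> \<le> \<eta> * (lam + p lam) \<and>
    \<bar>c lam - L * p lam\<bar> \<le> \<eta> * (lam + p lam)"
proof -
  have "\<forall>\<^sub>F lam in at_right 0. \<bar>v lam - L\<bar> < \<eta> / 2"
    using tendstoD[OF lim(1), of "\<eta> / 2"] \<eta> by (simp add: dist_real_def)
  moreover have "\<forall>\<^sub>F lam in at_right 0. \<bar>lam * v' lam\<bar> < \<eta> / 2"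
    using tendstoD[OF lim(2), of "\<eta> / 2"] \<eta> by (simp add: dist_real_def)
  moreover have "\<forall>\<^sub>F lam::real in at_right 0. 0 < lam \<and> lam < 1"
    by (rule eventually_at_rightI[of 0 1]) auto
  ultimately show ?thesis
    using bellman envelope
  proof eventually_elim
    case (elim lam)
    define K where "K = lam + (1 - lam) * p lam"
    have K: "0 \<le> K" "K \<le> lam + p lam"
      using elim(3) p[of lam] mult_left_le_one_le[of "p lam" lam]
      by (simp_all add: K_def left_diff_distrib)
    have balance: "lam * (u lam - v lam) + (1 - lam) * (c lam - v lam * p lam) = 0"
      using elim(4) by (simp add: algebra_simps)
    have env: "(u lam - v lam) - (c lam - v lam * p lam) = v' lam * K"
      using elim(5) by (simp add: K_def)
    \<comment> \<open>Multiplying the envelope identity by \<open>lam\<close> and subtracting it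
      from the balance eliminates \<open>u lam - v lam\<close>.\<close>
    have c: "c lam - v lam * p lam = - ((lam * v' lam) * K)"
      using balance arg_cong[OF env, of "\<lambda>z. lam * z"] by (simp add: algebra_simps)
    have "u lam - v lam = (1 - lam) * (v' lam * K)"
      using c env by (simp add: algebra_simps)
    then have "lam * (u lam - v lam) = (1 - lam) * ((lam * v' lam) * K)"
      by simp
    then have "\<bar>lam * (u lam - v lam)\<bar> = (1 - lam) * (\<bar>lam * v' lam\<bar> * K)"
      using elim(3) K by (simp only: abs_mult) simp
    also have "\<dots> \<le> 1 * (\<eta> / 2 * (lam + p lam))"
      using elim K \<eta> by (intro mult_mono mult_nonneg_nonneg) auto
    finally have u: "lam * \<bar>u lam - v lam\<bar> \<le> \<eta> / 2 * (lam + p lam)"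
      using elim(3) by (simp add: abs_mult)
    have "\<bar>c lam - v lam * p lam\<bar> = \<bar>lam * v' lam\<bar> * K"
      using K by (simp only: c abs_minus_cancel abs_mult abs_of_nonneg)
    also have "\<dots> \<le> \<eta> / 2 * (lam + p lam)"
      using elim K \<eta> by (intro mult_mono) auto
    finally have c': "\<bar>c lam - v lam * p lam\<bar> \<le> \<eta> / 2 * (lam + p lam)" .
    have "lam * \<bar>u lam - L\<bar> \<le> lam * (\<bar>u lam - v lam\<bar> + \<bar>v lam - L\<bar>)"
      using elim(3) by (intro mult_left_mono) auto
    also have "\<dots> \<le> \<eta> / 2 * (lam + p lam) + lam * (\<eta> / 2)"
      unfolding distrib_left[of lam] using elim u by (intro add_mono mult_left_mono) auto
    also have "\<dots> = \<eta> * (lam + p lam) - \<eta> * p lam / 2"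
      by (simp add: algebra_simps add_divide_distrib)
    also have "\<dots> \<le> \<eta> * (lam + p lam)"
      using p[of lam] \<eta> by simp
    finally have 1: "lam * \<bar>u lam - L\<bar> \<le> \<eta> * (lam + p lam)" .
    have "c lam - L * p lam = (c lam - v lam * p lam) + (v lam - L) * p lam"
      by (simp add: algebra_simps)
    then have "\<bar>c lam - L * p lam\<bar> \<le> \<bar>c lam - v lam * p lam\<bar> + \<bar>v lam - L\<bar> * p lam"
      using p[of lam] by (metis abs_triangle_ineq abs_mult abs_of_nonneg)
    also have "\<dots> \<le> \<eta> / 2 * (lam + p lam) + \<eta> / 2 * p lam"
      using elim c' p[of lam] by (intro add_mono mult_right_mono) auto
    also have "\<dots> = \<eta> * (lam + p lam) - \<eta> * lam / 2"
      by (simp add: algebra_simps add_divide_distrib)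
    also have "\<dots> \<le> \<eta> * (lam + p lam)"
      using elim(3) \<eta> by simp
    finally show ?case
      using 1 by simp
  qed
qed

section \<open>Deviation along a play under a general evaluation\<close>

lemma late_weight:
  assumes \<theta>: "evaluation \<theta>" and "0 < \<epsilon>"
  shows "(\<Sum>m<n. if tail \<theta> m < \<epsilon> then \<theta> m else 0) \<le> \<epsilon>"
proof -
  \<comment> \<open>The induction needs this sharper bound: late weights are differences of
    consecutive tails and telescope.\<close>
  have "(\<Sum>m<n. if tail \<theta> m < \<epsilon> then \<theta> m else 0) \<le> max 0 (\<epsilon> - tail \<theta> n)"
  proof (induction n)
    case (Suc n)
    then show ?case
      using tail_Suc[OF \<theta>, of n] evaluation_nonneg[OF \<theta>, of n] by (auto simp: max_def split: if_splits)
  qed simp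
  then show ?thesis
    using tail_nonneg[OF \<theta>, of n] assms(2) by linarith
qed

text \<open>The deviation splits as \<open>S * (u - L)\<close> plus \<open>W - L * (1 - S)\<close>,
  the live and the absorbed part. At stages with tail at least \<open>\<epsilon>\<close> each part
  costs at most \<open>\<eta> * (1 / \<epsilon> + 1)\<close> in total; the later stages carry weight
  at most \<open>\<epsilon>\<close> and cost at most \<open>B * \<epsilon>\<close>.\<close>

lemma weighted_deviation_le:
  fixes S W u p c :: "nat \<Rightarrow> real"
  assumes \<theta>: "evaluation \<theta>" and \<epsilon>: "0 < \<epsilon>" and \<eta>: "0 \<le> \<eta>"
    and S: "S 0 = 1" "\<And>m. S (Suc m) = S m * (1 - p m)"
    and W: "W 0 = 0" "\<And>m. W (Suc m) = W m + S m * c m"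
    and p: "\<And>m. 0 \<le> p m" "\<And>m. p m \<le> 1"
    and u: "\<And>m. \<epsilon> \<le> tail \<theta> m \<Longrightarrow> \<theta> m / tail \<theta> m * \<bar>u m - L\<bar> \<le> \<eta> * (\<theta> m / tail \<theta> m + p m)"
    and c: "\<And>m. \<epsilon> \<le> tail \<theta> m \<Longrightarrow> \<bar>c m - L * p m\<bar> \<le> \<eta> * (\<theta> m / tail \<theta> m + p m)"
    and B: "\<And>m. \<bar>S m * u m + W m - L\<bar> \<le> B"
  shows "(\<Sum>m<n. \<theta> m * \<bar>S m * u m + W m - L\<bar>) \<le> 2 * \<eta> * (1 / \<epsilon> + 1) + B * \<epsilon>"
proof -
  have \<theta>0: "0 \<le> \<theta> m" for m
    using \<theta> by (rule evaluation_nonneg)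
  have partial: "(\<Sum>m<n. \<theta> m) \<le> 1" for n
    using tail_nonneg[OF \<theta>, of n] tail_eq[OF \<theta>, of n] by simp
  have S01: "0 \<le> S m" "S m \<le> 1" for m
  proof (induction m)
    case (Suc m)
    { case 1 then show ?case using Suc p[of m] S by simp }
    { case 2 then show ?case using Suc p[of m] S by (simp add: mult_le_one) }
  qed (simp_all add: S)
  \<comment> \<open>The error budget of an early stage, in units of \<open>\<eta>\<close>; late
    stages are charged separately.\<close>
  define a where "a m = (if \<epsilon> \<le> tail \<theta> m then S m * (\<theta> m / tail \<theta> m + p m) else 0)" for m
  define K where "K = 1 / \<epsilon> + 1"
  have a0: "0 \<le> a m" for m
    using S01[of m] p[of m] \<theta>0[of m] tail_nonneg[OF \<theta>, of m] by (simp add: a_def)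
  \<comment> \<open>Telescoping: \<open>S m * p m\<close> is the mass absorbed at stage
    \<open>m\<close>.\<close>
  have absorbed: "(\<Sum>m<n. S m * p m) = 1 - S n" for n
    by (induction n) (simp_all add: S algebra_simps)
  have a_le: "a m \<le> \<theta> m / \<epsilon> + S m * p m" for m
  proof (cases "\<epsilon> \<le> tail \<theta> m")
    case True
    have "S m * (\<theta> m / tail \<theta> m) \<le> 1 * (\<theta> m / \<epsilon>)"
      using True \<epsilon> \<theta>0[of m] S01[of m] by (intro mult_mono divide_left_mono) auto
    then show ?thesis
      using True by (simp add: a_def algebra_simps)
  qed (use S01[of m] p[of m] \<theta>0[of m] \<epsilon> in \<open>simp add: a_def\<close>)
  have sum_a: "(\<Sum>m<n. a m) \<le> K" for n
  proof -
    have "(\<Sum>m<n. a m) \<le> (\<Sum>m<n. \<theta> m) / \<epsilon> + (\<Sum>m<n. S m * p m)"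
      by (simp add: sum_mono a_le sum_divide_distrib flip: sum.distrib)
    also have "\<dots> \<le> K"
      unfolding K_def absorbed using partial[of n] \<epsilon> S01[of n]
      by (intro add_mono divide_right_mono) auto
    finally show ?thesis .
  qed
  \<comment> \<open>Tails decrease, so early stages form an initial segment and the absorption
    errors before \<open>m\<close> are all covered by the budget.\<close>
  have W_dev: "\<bar>W m - L * (1 - S m)\<bar> \<le> \<eta> * (\<Sum>r<m. a r)" if "\<epsilon> \<le> tail \<theta> m" for m
    using that
  proof (induction m)
    case (Suc m)
    have t: "\<epsilon> \<le> tail \<theta> m"
      using Suc.prems tail_antimono[OF \<theta>, of m "Suc m"] by simp
    have "W (Suc m) - L * (1 - S (Suc m)) = (W m - L * (1 - S m)) + S m * (c m - L * p m)"
      by (simp add: S W algebra_simps)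
    then have "\<bar>W (Suc m) - L * (1 - S (Suc m))\<bar> \<le>
        \<bar>W m - L * (1 - S m)\<bar> + S m * \<bar>c m - L * p m\<bar>"
      using S01(1)[of m] by (metis abs_triangle_ineq abs_mult abs_of_nonneg)
    also have "\<dots> \<le> \<eta> * (\<Sum>r<m. a r) + S m * (\<eta> * (\<theta> m / tail \<theta> m + p m))"
      using Suc.IH t c[OF t] S01[of m] by (intro add_mono mult_left_mono) auto
    also have "\<dots> = \<eta> * (\<Sum>r<Suc m. a r)"
      using t by (simp add: a_def algebra_simps)
    finally show ?case .
  qed (simp add: S W)
  have "\<theta> m * \<bar>S m * u m + W m - L\<bar> \<le>
      \<eta> * a m + \<eta> * K * \<theta> m + B * (if tail \<theta> m < \<epsilon> then \<theta> m else 0)" for m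
  proof (cases "\<epsilon> \<le> tail \<theta> m")
    case True
    have "tail \<theta> m \<le> 1"
      using tail_antimono[OF \<theta>, of 0 m] tail_0[OF \<theta>] by simp
    \<comment> \<open>The estimate \<open>u\<close> is weighted by the share
      \<open>\<theta> m / tail \<theta> m\<close>, which dominates \<open>\<theta> m\<close> because
      the tail is at most 1.\<close>
    then have lam: "\<theta> m \<le> \<theta> m / tail \<theta> m"
      using True \<epsilon> \<theta>0[of m] by (simp add: field_simps mult_left_le)
    have "S m * u m + W m - L = S m * (u m - L) + (W m - L * (1 - S m))"
      by (simp add: algebra_simps)
    then have "\<theta> m * \<bar>S m * u m + W m - L\<bar> \<le>
        \<theta> m * (S m * \<bar>u m - L\<bar> + \<bar>W m - L * (1 - S m)\<bar>)"
      using S01(1)[of m] \<theta>0[of m]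
      by (intro mult_left_mono) (metis abs_triangle_ineq abs_mult abs_of_nonneg, simp)
    also have "\<dots> = S m * (\<theta> m * \<bar>u m - L\<bar>) + \<theta> m * \<bar>W m - L * (1 - S m)\<bar>"
      by (simp add: algebra_simps)
    also have "\<dots> \<le> S m * (\<theta> m / tail \<theta> m * \<bar>u m - L\<bar>) + \<theta> m * (\<eta> * (\<Sum>r<m. a r))"
      using S01(1)[of m] \<theta>0[of m] lam W_dev[OF True]
      by (intro add_mono mult_left_mono mult_right_mono) auto
    also have "\<dots> \<le> S m * (\<eta> * (\<theta> m / tail \<theta> m + p m)) + \<theta> m * (\<eta> * K)"
      using S01(1)[of m] \<theta>0[of m] u[OF True] sum_a[of m] \<eta>
      by (intro add_mono mult_left_mono) auto
    also have "\<dots> = \<eta> * a m + \<eta> * K * \<theta> m"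
      using True by (simp add: a_def algebra_simps)
    finally show ?thesis
      using True by simp
  next
    case False
    have "\<theta> m * \<bar>S m * u m + W m - L\<bar> \<le> \<theta> m * B"
      using B[of m] \<theta>0[of m] by (intro mult_left_mono) auto
    moreover have "0 \<le> \<eta> * a m + \<eta> * K * \<theta> m"
      using \<eta> a0[of m] \<theta>0[of m] \<epsilon> by (simp add: K_def)
    ultimately show ?thesis
      using False by (simp add: mult.commute)
  qed
  then have "(\<Sum>m<n. \<theta> m * \<bar>S m * u m + W m - L\<bar>) \<le>
      (\<Sum>m<n. \<eta> * a m + \<eta> * K * \<theta> m + B * (if tail \<theta> m < \<epsilon> then \<theta> m else 0))"
    by (rule sum_mono)
  also have "\<dots> = \<eta> * (\<Sum>m<n. a m) + \<eta> * K * (\<Sum>m<n. \<theta> m) +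
      B * (\<Sum>m<n. if tail \<theta> m < \<epsilon> then \<theta> m else 0)"
    by (simp add: sum.distrib sum_distrib_left)
  also have "\<dots> \<le> \<eta> * K + \<eta> * K * 1 + B * \<epsilon>"
    using \<eta> sum_a[of n] partial[of n] late_weight[OF \<theta> \<epsilon>, of n] order_trans[OF abs_ge_zero B] \<epsilon>
    by (intro add_mono mult_left_mono) (auto simp: K_def)
  finally show ?thesis
    by (simp add: K_def)
qed

subsection \<open>Optimal strategies in absorbing games\<close>

locale absorbing_optimal =
  fixes g :: "'k::finite \<Rightarrow> 'i::finite \<Rightarrow> 'j::finite \<Rightarrow> real"
    and q :: "'k \<Rightarrow> 'i \<Rightarrow> 'j \<Rightarrow> 'k pmf"
    and k :: 'k
    and x :: "real \<Rightarrow> 'k \<Rightarrow> 'i pmf"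
    and y :: "real \<Rightarrow> 'k \<Rightarrow> 'j pmf"
  assumes absorbing: "absorbing_game q k"
    and opt1: "\<And>lam. 0 < lam \<Longrightarrow> lam \<le> 1 \<Longrightarrow> optimal1 g q lam (x lam)"
    and opt2: "\<And>lam. 0 < lam \<Longrightarrow> lam \<le> 1 \<Longrightarrow> optimal2 g q lam (y lam)"
    and puiseux1: "\<And>l i. puiseux_near_0 (\<lambda>lam. pmf (x lam l) i)"
    and puiseux2: "\<And>l j. puiseux_near_0 (\<lambda>lam. pmf (y lam l) j)"
begin

definition v :: "real \<Rightarrow> 'k \<Rightarrow> real" where
  "v lam l = game_value g q (discounted lam) l"

text \<open>The rate 1 is an arbitrary representative: at absorbing states the value is the same for
  all rates, as \<open>absorbed_value\<close> shows.\<close>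

definition w :: "'k \<Rightarrow> real" where
  "w = v 1"

lemma v_le_payoff:
  assumes "0 < a" "a \<le> 1"
  shows "v a l \<le> payoff g q (discounted a) l (stationary (x a)) (stationary (y b)) 1"
  using opt1[OF assms] by (simp add: optimal1_def v_def)

lemma payoff_le_v:
  assumes "0 < b" "b \<le> 1"
  shows "payoff g q (discounted b) l (stationary (x a)) (stationary (y b)) 1 \<le> v b l"
  using opt2[OF assms] by (simp add: optimal2_def v_def)

text \<open>The payoff of \<open>(x a, y b)\<close> lies between \<open>v a l\<close> and
  \<open>v b l\<close> for all rates \<open>a\<close>, \<open>b\<close>; exchanging the rates gives
  equality throughout.\<close>

lemma absorbed_value:
  assumes "l \<noteq> k" and "0 < a" "a \<le> 1" and "0 < b" "b \<le> 1"
  shows "mix (x a l) (y b l) (g l) = w l"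
proof -
  have between: "v a l \<le> mix (x a l) (y b l) (g l) \<and> mix (x a l) (y b l) (g l) \<le> v b l"
    if "0 < a" "a \<le> 1" "0 < b" "b \<le> 1" for a b
    using v_le_payoff[OF that(1,2), of l b] payoff_le_v[OF that(3,4), of l a]
      payoff_discounted_absorbed[OF absorbing assms(1), of _ g "x a" "y b"] that by simp
  then have "v a l \<le> v b l" if "0 < a" "a \<le> 1" "0 < b" "b \<le> 1" for a b
    using order_trans that by blast
  then have "v a l = w l" "v b l = w l"
    using assms by (auto simp: w_def intro!: antisym)
  then show ?thesis
    using between[OF assms(2-5)] by simp
qed

text \<open>The two players may use strategies tuned to different rates, as the envelope argument
  requires.\<close>

abbreviation u_at where "u_at a b \<equiv> mix (x a k) (y b k) (g k)"
abbreviation p_at where "p_at a b \<equiv> mix (x a k) (y b k) (leave q k)"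
abbreviation c_at where "c_at a b \<equiv> mix (x a k) (y b k) (exit_reward q k w)"

lemma p_at_nonneg: "0 \<le> p_at a b"
  by (intro mix_nonneg leave_nonneg)

lemma live_payoff:
  assumes "0 < lam" "lam \<le> 1" and "0 < a" "a \<le> 1" and "0 < b" "b \<le> 1"
  shows "payoff g q (discounted lam) k (stationary (x a)) (stationary (y b)) 1 *
    (lam + (1 - lam) * p_at a b) = lam * u_at a b + (1 - lam) * c_at a b"
  using absorbed_value assms by (intro payoff_discounted_live absorbing) auto

text \<open>In the game with rate \<open>a\<close>, \<open>x a\<close> guarantees the value also
  against \<open>y b\<close>, which is tuned to another rate. Multiplying by the positive
  denominator removes the payoff.\<close>

lemma deviation1:
  assumes "0 < a" "a \<le> 1" and "0 < b" "b \<le> 1"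
  shows "0 \<le> a * (u_at a b - v a k) + (1 - a) * (c_at a b - v a k * p_at a b)"
proof -
  have "v a k * (a + (1 - a) * p_at a b) \<le>
      payoff g q (discounted a) k (stationary (x a)) (stationary (y b)) 1 * (a + (1 - a) * p_at a b)"
    using assms p_at_nonneg[of a b] by (intro mult_right_mono v_le_payoff) auto
  then show ?thesis
    using live_payoff[OF assms(1,2) assms] by (simp add: algebra_simps)
qed

lemma deviation2:
  assumes "0 < a" "a \<le> 1" and "0 < b" "b \<le> 1"
  shows "b * (u_at a b - v b k) + (1 - b) * (c_at a b - v b k * p_at a b) \<le> 0"
proof -
  have "payoff g q (discounted b) k (stationary (x a)) (stationary (y b)) 1 *
      (b + (1 - b) * p_at a b) \<le> v b k * (b + (1 - b) * p_at a b)"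
    using assms p_at_nonneg[of a b] by (intro mult_right_mono payoff_le_v) auto
  then show ?thesis
    using live_payoff[OF assms(3,4) assms] by (simp add: algebra_simps)
qed

lemma bellman:
  assumes "0 < a" "a \<le> 1"
  shows "v a k * (a + (1 - a) * p_at a a) = a * u_at a a + (1 - a) * c_at a a"
  using deviation1[OF assms assms] deviation2[OF assms assms] by (simp add: algebra_simps)

lemma common_germ:
  obtains M where "M > 0" and "\<forall>l i. puiseux_germ M (\<lambda>lam. pmf (x lam l) i)"
    and "\<forall>l j. puiseux_germ M (\<lambda>lam. pmf (y lam l) j)"
proof -
  have "\<exists>M>0. \<forall>f\<in>range (\<lambda>(l, i) lam. pmf (x lam l) i) \<union> range (\<lambda>(l, j) lam. pmf (y lam l) j).
      puiseux_germ M f"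
    using puiseux1 puiseux2 by (intro common_puiseux_germ) auto
  then obtain M where M: "M > 0"
    "\<And>f. f \<in> range (\<lambda>(l, i) lam. pmf (x lam l) i) \<Longrightarrow> puiseux_germ M f"
    "\<And>f. f \<in> range (\<lambda>(l, j) lam. pmf (y lam l) j) \<Longrightarrow> puiseux_germ M f"
    by blast
  have "puiseux_germ M (\<lambda>lam. pmf (x lam l) i)" for l i
    by (rule M(2), rule image_eqI[of _ _ "(l, i)"]) simp_all
  moreover have "puiseux_germ M (\<lambda>lam. pmf (y lam l) j)" for l j
    by (rule M(3), rule image_eqI[of _ _ "(l, j)"]) simp_all
  ultimately show ?thesis
    by (intro that[OF M(1)] allI)
qed

lemma tendsto_extend:
  shows "((\<lambda>lam. pmf (x lam l) i) \<longlongrightarrow> pmf (extend_at_0 x 0 l) i) (at_right 0)"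
    and "((\<lambda>lam. pmf (y lam l) j) \<longlongrightarrow> pmf (extend_at_0 y 0 l) j) (at_right 0)"
proof -
  obtain M where M: "M > 0" and germ: "\<forall>l i. puiseux_germ M (\<lambda>lam. pmf (x lam l) i)"
    "\<forall>l j. puiseux_germ M (\<lambda>lam. pmf (y lam l) j)"
    by (rule common_germ)
  have "\<exists>L. (f \<longlongrightarrow> L) (at_right 0)" if "puiseux_germ M f" for f
    by (rule puiseux_germ_regular[OF M that]) (rule exI)
  then show "((\<lambda>lam. pmf (x lam l) i) \<longlongrightarrow> pmf (extend_at_0 x 0 l) i) (at_right 0)"
    and "((\<lambda>lam. pmf (y lam l) j) \<longlongrightarrow> pmf (extend_at_0 y 0 l) j) (at_right 0)"
    using germ by (auto intro!: pmf_extend_at_0)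
qed

text \<open>The Bellman equation writes the value as a quotient of Puiseux germs. The quotient is
  bounded, hence a germ itself.\<close>

lemma value_regular:
  obtains L v' where "((\<lambda>lam. v lam k) \<longlongrightarrow> L) (at_right 0)"
    and "\<forall>\<^sub>F lam in at_right 0. ((\<lambda>lam. v lam k) has_real_derivative v' lam) (at lam)"
    and "((\<lambda>lam. lam * v' lam) \<longlongrightarrow> 0) (at_right 0)"
proof -
  obtain M where M: "M > 0" and germ: "\<forall>l i. puiseux_germ M (\<lambda>lam. pmf (x lam l) i)"
    "\<forall>l j. puiseux_germ M (\<lambda>lam. pmf (y lam l) j)"
    by (rule common_germ)
  define num den where "num lam = lam * u_at lam lam + (1 - lam) * c_at lam lam"
    and "den lam = lam + (1 - lam) * p_at lam lam" for lam
  have germs: "puiseux_germ M num" "puiseux_germ M den"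
    unfolding num_def den_def
    by (intro puiseux_germ_add puiseux_germ_mult puiseux_germ_diff puiseux_germ_const
        puiseux_germ_ident puiseux_germ_mix germ[rule_format])+
  have v_eq: "v lam k = num lam / den lam" if "0 < lam" "lam \<le> 1" for lam
  proof -
    have "0 < den lam"
      unfolding den_def using that p_at_nonneg[of lam lam] by (intro add_pos_nonneg) auto
    then show ?thesis
      using bellman[OF that] by (simp add: num_def den_def field_simps)
  qed
  obtain B1 where B1: "\<forall>a. \<bar>case a of (i, j) \<Rightarrow> g k i j\<bar> \<le> B1"
    by (rule finite_abs_bound)
  obtain B2 where B2: "\<forall>l. \<bar>w l\<bar> \<le> B2"
    by (rule finite_abs_bound)
  define G where "G = max B1 B2"
  have G: "\<bar>g k i j\<bar> \<le> G" "\<bar>w l\<bar> \<le> G" for i j l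
    using B1[rule_format, of "(i, j)"] B2[rule_format, of l] by (auto simp: G_def)
  have bound: "\<bar>num lam / den lam\<bar> \<le> G" if "0 < lam" "lam < 1" for lam
  proof -
    have den: "0 < den lam"
      unfolding den_def using that p_at_nonneg[of lam lam] by (intro add_pos_nonneg) auto
    \<comment> \<open>The exit reward is at most \<open>G\<close> times the leaving probability,
      which yields \<open>\<bar>num lam\<bar> \<le> G * den lam\<close> even where
      \<open>den\<close> tends to 0.\<close>
    have "\<bar>c_at lam lam\<bar> \<le> mix (x lam k) (y lam k) (\<lambda>i j. G * leave q k i j)"
      by (rule order_trans[OF abs_mix_le mix_mono]) (rule exit_reward_abs_le[OF G(2)])
    then have "\<bar>c_at lam lam\<bar> \<le> G * p_at lam lam"
      by (simp add: mix_cmult)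
    then have "\<bar>num lam\<bar> \<le> lam * G + (1 - lam) * (G * p_at lam lam)"
      unfolding num_def using that mix_abs_le[of "g k" G "x lam k" "y lam k"] G(1)
      by (intro order_trans[OF abs_triangle_ineq] add_mono) (auto simp: abs_mult mult_left_mono)
    also have "\<dots> = G * den lam"
      by (simp add: den_def algebra_simps)
    finally show ?thesis
      using den by (simp add: field_simps)
  qed
  then have "\<forall>\<^sub>F lam in at_right 0. \<bar>num lam / den lam\<bar> \<le> G"
    by (intro eventually_at_rightI[of 0 1]) auto
  then have germ_v: "puiseux_germ M (\<lambda>lam. num lam / den lam)"
    by (rule puiseux_germ_divide_bounded[OF M germs])
  obtain L v' where L: "((\<lambda>lam. num lam / den lam) \<longlongrightarrow> L) (at_right 0)"
    and v': "\<forall>\<^sub>F lam in at_right 0. ((\<lambda>lam. num lam / den lam) has_real_derivative v' lam) (at lam)"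
    and lim: "((\<lambda>lam. lam * v' lam) \<longlongrightarrow> 0) (at_right 0)"
    by (rule puiseux_germ_regular[OF M germ_v])
  have small: "\<forall>\<^sub>F lam::real in at_right 0. 0 < lam \<and> lam < 1"
    by (rule eventually_at_rightI[of 0 1]) auto
  have "((\<lambda>lam. v lam k) \<longlongrightarrow> L) (at_right 0)"
    by (rule Lim_transform_eventually[OF L], use small in eventually_elim) (simp add: v_eq)
  moreover have "\<forall>\<^sub>F lam in at_right 0. ((\<lambda>lam. v lam k) has_real_derivative v' lam) (at lam)"
    using v' small
  proof eventually_elim
    case (elim lam)
    then show ?case
      by (intro has_field_derivative_transform_within_open[where S="{0<..<1}", OF elim(1)])
        (auto simp: v_eq)
  qed
  ultimately show ?thesis
    using lim by (rule that)
qed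

text \<open>Only the strategy of Player 2 moves with \<open>mu\<close>. The fixed mixed action is
  quantified inside, because it will be \<open>x lam k\<close>, which varies with the point
  \<open>lam\<close>.\<close>

lemma eventually_continuous:
  "\<forall>\<^sub>F lam in at_right 0. \<forall>(a :: 'i pmf) f. isCont (\<lambda>mu. mix a (y mu k) f) lam"
proof -
  obtain M where M: "M > 0" and "\<forall>l i. puiseux_germ M (\<lambda>lam. pmf (x lam l) i)"
    and germ: "\<forall>l j. puiseux_germ M (\<lambda>lam. pmf (y lam l) j)"
    by (rule common_germ)
  have "\<forall>\<^sub>F lam in at_right 0. isCont (\<lambda>mu. pmf (y mu k) j) lam" for j
  proof -
    obtain L f' where "((\<lambda>mu. pmf (y mu k) j) \<longlongrightarrow> L) (at_right 0)"
      and deriv: "\<forall>\<^sub>F lam in at_right 0. ((\<lambda>mu. pmf (y mu k) j) has_real_derivative f' lam) (at lam)"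
      and "((\<lambda>lam. lam * f' lam) \<longlongrightarrow> 0) (at_right 0)"
      by (rule puiseux_germ_regular[OF M germ[rule_format]])
    from deriv show ?thesis
      by eventually_elim (rule DERIV_isCont)
  qed
  then have "\<forall>\<^sub>F lam in at_right 0. \<forall>j. isCont (\<lambda>mu. pmf (y mu k) j) lam"
    by (rule eventually_all_finite)
  then show ?thesis
  proof eventually_elim
    case (elim lam)
    then show ?case
      unfolding isCont_def by (intro allI tendsto_mix) auto
  qed
qed

lemma balance:
  obtains L where "limit_value g q k = L"
    and "\<forall>\<eta>>0. \<forall>\<^sub>F lam in at_right 0. lam * \<bar>u_at lam lam - L\<bar> \<le> \<eta> * (lam + p_at lam lam) \<and>
      \<bar>c_at lam lam - L * p_at lam lam\<bar> \<le> \<eta> * (lam + p_at lam lam)"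
proof -
  obtain L v' where L: "((\<lambda>lam. v lam k) \<longlongrightarrow> L) (at_right 0)"
    and v': "\<forall>\<^sub>F lam in at_right 0. ((\<lambda>lam. v lam k) has_real_derivative v' lam) (at lam)"
    and lim: "((\<lambda>lam. lam * v' lam) \<longlongrightarrow> 0) (at_right 0)"
    by (rule value_regular)
  have small: "\<forall>\<^sub>F lam::real in at_right 0. 0 < lam \<and> lam < 1"
    by (rule eventually_at_rightI[of 0 1]) auto
  have bell: "\<forall>\<^sub>F lam in at_right 0. v lam k * (lam + (1 - lam) * p_at lam lam) =
      lam * u_at lam lam + (1 - lam) * c_at lam lam"
    using small by eventually_elim (simp add: bellman)
  have envelope: "\<forall>\<^sub>F lam in at_right 0. (u_at lam lam - v lam k) - (c_at lam lam - v lam k * p_at lam lam) =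
      v' lam * (lam + (1 - lam) * p_at lam lam)"
    using small v' eventually_continuous
  proof eventually_elim
    case (elim lam)
    \<comment> \<open>Optimality of \<open>y mu\<close> is available only for rates in the unit
      interval.\<close>
    have near: "\<forall>\<^sub>F mu in at lam. mu \<in> {0<..<1}"
      using elim(1) by (intro eventually_at_in_open') auto
    show ?case
    proof (rule envelope_identity[of "\<lambda>lam. v lam k" "v' lam" lam "\<lambda>mu. u_at lam mu"
          "\<lambda>mu. c_at lam mu" "\<lambda>mu. p_at lam mu"])
      show "((\<lambda>lam. v lam k) has_real_derivative v' lam) (at lam)"
        by (rule elim(2))
      show "\<forall>\<^sub>F mu in at lam. 0 \<le> lam * (u_at lam mu - v lam k) +
          (1 - lam) * (c_at lam mu - v lam k * p_at lam mu)"
        using near by eventually_elim (use elim(1) in \<open>auto intro!: deviation1\<close>)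
      show "\<forall>\<^sub>F mu in at lam. mu * (u_at lam mu - v mu k) +
          (1 - mu) * (c_at lam mu - v mu k * p_at lam mu) \<le> 0"
        using near by eventually_elim (use elim(1) in \<open>auto intro!: deviation2\<close>)
    qed (use elim(3) in auto)
  qed
  have "limit_value g q k = L"
    unfolding limit_value_def v_def[symmetric] using L by (intro tendsto_Lim) auto
  moreover have "\<forall>\<^sub>F lam in at_right 0. lam * \<bar>u_at lam lam - L\<bar> \<le> \<eta> * (lam + p_at lam lam) \<and>
      \<bar>c_at lam lam - L * p_at lam lam\<bar> \<le> \<eta> * (lam + p_at lam lam)" if "0 < \<eta>" for \<eta>
    using p_at_nonneg that
    by (intro balance_estimate[where u="\<lambda>lam. u_at lam lam" and p="\<lambda>lam. p_at lam lam"
          and c="\<lambda>lam. c_at lam lam", OF L lim _ bell envelope]) auto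
  ultimately show ?thesis
    by (intro that allI impI)
qed

section \<open>Including rate 0, and convergence of the payoffs\<close>

lemma absorbed_value_extend:
  assumes "l \<noteq> k" and "0 \<le> lam" "lam \<le> 1"
  shows "mix (extend_at_0 x lam l) (extend_at_0 y lam l) (g l) = w l"
proof (cases "lam = 0")
  case True
  have "((\<lambda>lam. mix (x lam l) (y lam l) (g l)) \<longlongrightarrow>
      mix (extend_at_0 x 0 l) (extend_at_0 y 0 l) (g l)) (at_right 0)"
    by (intro tendsto_mix tendsto_extend)
  moreover have "\<forall>\<^sub>F lam in at_right 0. mix (x lam l) (y lam l) (g l) = w l"
    by (rule eventually_at_rightI[of 0 1]) (use absorbed_value[OF assms(1)] in auto)
  ultimately have "((\<lambda>lam::real. w l) \<longlongrightarrow>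
      mix (extend_at_0 x 0 l) (extend_at_0 y 0 l) (g l)) (at_right 0)"
    by (rule Lim_transform_eventually)
  then show ?thesis
    using True by (simp add: tendsto_const_iff)
next
  case False
  then show ?thesis
    using absorbed_value[OF assms(1), of lam lam] assms by (simp add: extend_at_0_def)
qed

text \<open>Rate 0 occurs at stages of weight 0. There the first inequality only says that
  \<open>\<eta> * p\<close> is nonnegative, and the second passes to the limit.\<close>

lemma balance_extend:
  obtains L where "limit_value g q k = L"
    and "\<forall>\<eta>>0. \<exists>\<delta>>0. \<forall>lam. 0 \<le> lam \<and> lam < \<delta> \<longrightarrow>
      (let X = extend_at_0 x lam k; Y = extend_at_0 y lam k; p = mix X Y (leave q k) in
       lam * \<bar>mix X Y (g k) - L\<bar> \<le> \<eta> * (lam + p) \<and>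
       \<bar>mix X Y (exit_reward q k w) - L * p\<bar> \<le> \<eta> * (lam + p))"
proof -
  obtain L where L: "limit_value g q k = L"
    and ev: "\<forall>\<eta>>0. \<forall>\<^sub>F lam in at_right 0. lam * \<bar>u_at lam lam - L\<bar> \<le> \<eta> * (lam + p_at lam lam) \<and>
      \<bar>c_at lam lam - L * p_at lam lam\<bar> \<le> \<eta> * (lam + p_at lam lam)"
    by (rule balance)
  show ?thesis
  proof (rule that[OF L], intro allI impI)
    fix \<eta> :: real assume \<eta>: "0 < \<eta>"
    define X Y where "X = extend_at_0 x 0 k" and "Y = extend_at_0 y 0 k"
    have lim: "((\<lambda>lam. mix (x lam k) (y lam k) f) \<longlongrightarrow> mix X Y f) (at_right 0)" for f
      unfolding X_def Y_def by (intro tendsto_mix tendsto_extend)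
    have "\<bar>mix X Y (exit_reward q k w) - L * mix X Y (leave q k)\<bar> \<le> \<eta> * (0 + mix X Y (leave q k))"
    proof (rule tendsto_le)
      show "((\<lambda>lam. \<bar>c_at lam lam - L * p_at lam lam\<bar>) \<longlongrightarrow>
          \<bar>mix X Y (exit_reward q k w) - L * mix X Y (leave q k)\<bar>) (at_right 0)"
        by (intro tendsto_intros lim)
      show "((\<lambda>lam. \<eta> * (lam + p_at lam lam)) \<longlongrightarrow> \<eta> * (0 + mix X Y (leave q k))) (at_right 0)"
        by (intro tendsto_intros lim)
      show "\<forall>\<^sub>F lam in at_right 0. \<bar>c_at lam lam - L * p_at lam lam\<bar> \<le> \<eta> * (lam + p_at lam lam)"
        using ev[rule_format, OF \<eta>] by eventually_elim simp
    qed simp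
    moreover have "0 \<le> mix X Y (leave q k)"
      by (intro mix_nonneg leave_nonneg)
    moreover obtain \<delta> where "\<delta> > 0" "\<And>lam. 0 < lam \<Longrightarrow> lam < \<delta> \<Longrightarrow>
        lam * \<bar>u_at lam lam - L\<bar> \<le> \<eta> * (lam + p_at lam lam) \<and>
        \<bar>c_at lam lam - L * p_at lam lam\<bar> \<le> \<eta> * (lam + p_at lam lam)"
      using ev[rule_format, OF \<eta>] unfolding eventually_at_right_field by blast
    ultimately show "\<exists>\<delta>>0. \<forall>lam. 0 \<le> lam \<and> lam < \<delta> \<longrightarrow>
      (let X = extend_at_0 x lam k; Y = extend_at_0 y lam k; p = mix X Y (leave q k) in
       lam * \<bar>mix X Y (g k) - L\<bar> \<le> \<eta> * (lam + p) \<and>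
       \<bar>mix X Y (exit_reward q k w) - L * p\<bar> \<le> \<eta> * (lam + p))"
      using \<eta> by (intro exI[of _ \<delta>]) (auto simp: Let_def X_def Y_def extend_at_0_def)
  qed
qed

lemma payoff_close:
  assumes \<theta>: "evaluation \<theta>" and t: "0 \<le> t" "t \<le> 1"
    and \<sigma>: "follows x \<theta> \<sigma>" and \<tau>: "follows y \<theta> \<tau>"
    and \<epsilon>: "0 < \<epsilon>" and \<eta>: "0 < \<eta>" and small: "eval_norm \<theta> < \<delta> * \<epsilon>"
    and bal: "\<And>lam. 0 \<le> lam \<Longrightarrow> lam < \<delta> \<Longrightarrow>
      (let X = extend_at_0 x lam k; Y = extend_at_0 y lam k; p = mix X Y (leave q k) in
       lam * \<bar>mix X Y (g k) - L\<bar> \<le> \<eta> * (lam + p) \<and>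
       \<bar>mix X Y (exit_reward q k w) - L * p\<bar> \<le> \<eta> * (lam + p))"
    and G: "\<And>s i j. \<bar>g s i j\<bar> \<le> G"
  shows "\<bar>payoff g q \<theta> k \<sigma> \<tau> t - t * L\<bar> \<le>
    2 * \<eta> * (1 / \<epsilon> + 1) + (G + \<bar>L\<bar>) * \<epsilon> + \<bar>L\<bar> * eval_norm \<theta>"
proof -
  \<comment> \<open>When the tail is 0 the quotient is 0 by convention, so \<open>X m\<close> is
    then the limit strategy. \<open>\<sigma>\<close> may differ from it there, which
    \<open>payoff_markov\<close> allows.\<close>
  define X where "X m = extend_at_0 x (\<theta> m / tail \<theta> m)" for m
  define Y where "Y m = extend_at_0 y (\<theta> m / tail \<theta> m)" for m
  define S where "S m = pmf (state_law q k X Y m) k" for m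
  define W where "W m = (\<Sum>l\<in>-{k}. pmf (state_law q k X Y m) l * w l)" for m
  define u p c where "u m = mix (X m k) (Y m k) (g k)" and "p m = mix (X m k) (Y m k) (leave q k)"
    and "c m = mix (X m k) (Y m k) (exit_reward q k w)" for m
  have \<sigma>': "\<And>h s. tail \<theta> (length h) \<noteq> 0 \<Longrightarrow> \<sigma> h s = X (length h) s"
    and \<tau>': "\<And>h s. tail \<theta> (length h) \<noteq> 0 \<Longrightarrow> \<tau> h s = Y (length h) s"
    using \<sigma> \<tau> by (simp_all add: follows_def X_def Y_def)
  have ratio: "0 \<le> \<theta> m / tail \<theta> m" "\<theta> m / tail \<theta> m \<le> 1" for m
    using evaluation_nonneg[OF \<theta>, of m] weight_le_tail[OF \<theta>, of m]
    by (auto simp: divide_le_eq_1)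
  have stage: "(\<Sum>s\<in>UNIV. pmf (state_law q k X Y m) s * mix (X m s) (Y m s) (g s)) = S m * u m + W m"
    for m
  proof -
    have "mix (X m l) (Y m l) (g l) = w l" if "l \<noteq> k" for l
      unfolding X_def Y_def using ratio[of m] by (intro absorbed_value_extend[OF that])
    then show ?thesis
      unfolding S_def W_def u_def
      by (subst sum.remove[of _ k]) (auto simp: Compl_eq_Diff_UNIV intro!: sum.cong)
  qed
  have "\<bar>S m * u m + W m\<bar> \<le> G" for m
  proof -
    have "\<bar>\<Sum>s\<in>UNIV. pmf (state_law q k X Y m) s * mix (X m s) (Y m s) (g s)\<bar> \<le>
        (\<Sum>s\<in>UNIV. pmf (state_law q k X Y m) s * G)"
      by (intro order_trans[OF sum_abs] sum_mono)
        (simp add: abs_mult mult_left_mono mix_abs_le G)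
    also have "\<dots> = G"
      by (simp add: sum_pmf_eq_1 flip: sum_distrib_right)
    finally show ?thesis
      by (simp add: stage)
  qed
  then have B: "\<bar>S m * u m + W m - L\<bar> \<le> G + \<bar>L\<bar>" for m
    by (rule order_trans[OF abs_triangle_ineq4 add_right_mono])
  have bal_m: "\<theta> m / tail \<theta> m * \<bar>u m - L\<bar> \<le> \<eta> * (\<theta> m / tail \<theta> m + p m) \<and>
      \<bar>c m - L * p m\<bar> \<le> \<eta> * (\<theta> m / tail \<theta> m + p m)" if "\<epsilon> \<le> tail \<theta> m" for m
  proof -
    \<comment> \<open>At early stages a small norm makes the induced rate small, so that the balance
      estimate holds there.\<close>
    have "\<theta> m / tail \<theta> m \<le> eval_norm \<theta> / \<epsilon>"
      using that \<epsilon> weight_le_eval_norm[OF \<theta>, of m] evaluation_nonneg[OF \<theta>, of m]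
      by (intro frac_le) auto
    also have "\<dots> < \<delta>"
      using small \<epsilon> by (simp add: divide_less_eq)
    finally show ?thesis
      using bal[OF ratio(1)] by (simp add: Let_def u_def p_def c_def X_def Y_def)
  qed
  have "(\<Sum>m<n. \<theta> m * \<bar>S m * u m + W m - L\<bar>) \<le> 2 * \<eta> * (1 / \<epsilon> + 1) + (G + \<bar>L\<bar>) * \<epsilon>" for n
  proof (rule weighted_deviation_le[OF \<theta> \<epsilon>, where p=p and c=c])
    show "S 0 = 1" "W 0 = 0"
      by (simp_all add: S_def W_def indicator_def)
    show "S (Suc m) = S m * (1 - p m)" for m
      unfolding S_def p_def by (rule live_Suc[OF absorbing])
    show "W (Suc m) = W m + S m * c m" for m
      unfolding S_def W_def c_def by (rule absorbed_Suc[OF absorbing])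
    show "0 \<le> p m" "p m \<le> 1" for m
      unfolding p_def using mix_mono[of "leave q k" "\<lambda>_ _. 1" "X m k" "Y m k"]
      by (auto intro: mix_nonneg simp: leave_nonneg leave_le_1)
  qed (use \<eta> bal_m B in auto)
  from clocked_average_close[OF \<theta> t this]
  have "\<bar>(\<Sum>m. if enat m < clock \<theta> t then \<theta> m * (S m * u m + W m) else 0) - t * L\<bar> \<le>
      2 * \<eta> * (1 / \<epsilon> + 1) + (G + \<bar>L\<bar>) * \<epsilon> + \<bar>L\<bar> * eval_norm \<theta>" .
  moreover have "payoff g q \<theta> k \<sigma> \<tau> t =
      (\<Sum>m. if enat m < clock \<theta> t then \<theta> m * (S m * u m + W m) else 0)"
    by (subst payoff_markov[where \<sigma>=\<sigma> and \<tau>=\<tau> and X=X and Y=Y, OF \<theta> \<sigma>' \<tau>']) (simp_all add: stage cong: if_cong)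
  ultimately show ?thesis
    by simp
qed

lemma payoff_tendsto:
  assumes "\<And>\<theta>. evaluation \<theta> \<Longrightarrow> follows x \<theta> (\<sigma> \<theta>)"
    and "\<And>\<theta>. evaluation \<theta> \<Longrightarrow> follows y \<theta> (\<tau> \<theta>)"
    and t: "0 \<le> t" "t \<le> 1"
  shows "((\<lambda>\<theta>. payoff g q \<theta> k (\<sigma> \<theta>) (\<tau> \<theta>) t) \<longlongrightarrow> t * limit_value g q k) vanishing"
proof (rule tendstoI)
  fix e :: real assume e: "0 < e"
  obtain L where L: "limit_value g q k = L"
    and bal: "\<forall>\<eta>>0. \<exists>\<delta>>0. \<forall>lam. 0 \<le> lam \<and> lam < \<delta> \<longrightarrow>
      (let X = extend_at_0 x lam k; Y = extend_at_0 y lam k; p = mix X Y (leave q k) in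
       lam * \<bar>mix X Y (g k) - L\<bar> \<le> \<eta> * (lam + p) \<and>
       \<bar>mix X Y (exit_reward q k w) - L * p\<bar> \<le> \<eta> * (lam + p))"
    by (rule balance_extend)
  obtain G where G': "\<forall>a. \<bar>case a of (s, i, j) \<Rightarrow> g s i j\<bar> \<le> G"
    by (rule finite_abs_bound)
  have G: "\<bar>g s i j\<bar> \<le> G" for s i j
    using G'[rule_format, of "(s, i, j)"] by simp
  have G0: "0 \<le> G"
    using order_trans[OF abs_ge_zero G] .
  \<comment> \<open>Each of the three error terms gets at most \<open>e / 4\<close>. The summand 1
    keeps the denominator positive when \<open>G\<close> and \<open>L\<close> vanish.\<close>
  define \<epsilon> where "\<epsilon> = e / (4 * (G + \<bar>L\<bar> + 1))"
  have \<epsilon>: "0 < \<epsilon>"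
    unfolding \<epsilon>_def using e G0 by (intro divide_pos_pos) auto
  have \<epsilon>_le: "(G + \<bar>L\<bar>) * \<epsilon> \<le> e / 4"
  proof -
    have "(G + \<bar>L\<bar>) * \<epsilon> \<le> (G + \<bar>L\<bar> + 1) * \<epsilon>"
      using \<epsilon> by simp
    also have "\<dots> = e / 4"
      unfolding \<epsilon>_def using G0 by (simp add: field_simps)
    finally show ?thesis .
  qed
  define K where "K = 1 / \<epsilon> + 1"
  define \<eta> where "\<eta> = e / (8 * K)"
  have "0 < K"
    using \<epsilon> by (simp add: K_def add_pos_pos)
  then have "0 < \<eta>" "2 * \<eta> * K = e / 4"
    using e by (simp_all add: \<eta>_def)
  then have \<eta>: "0 < \<eta>" "2 * \<eta> * (1 / \<epsilon> + 1) = e / 4"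
    by (simp_all add: K_def)
  obtain \<delta> where \<delta>: "\<delta> > 0" and bal': "\<And>lam. 0 \<le> lam \<Longrightarrow> lam < \<delta> \<Longrightarrow>
      (let X = extend_at_0 x lam k; Y = extend_at_0 y lam k; p = mix X Y (leave q k) in
       lam * \<bar>mix X Y (g k) - L\<bar> \<le> \<eta> * (lam + p) \<and>
       \<bar>mix X Y (exit_reward q k w) - L * p\<bar> \<le> \<eta> * (lam + p))"
    using bal \<eta>(1) by blast
  \<comment> \<open>The first bound keeps the early rates below \<open>\<delta>\<close>; the second
    makes the clock error \<open>\<bar>L\<bar> * eval_norm \<theta>\<close> at most
    \<open>e / 4\<close>.\<close>
  define d where "d = min (\<delta> * \<epsilon>) (e / (4 * (\<bar>L\<bar> + 1)))"
  have "0 < d"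
    unfolding d_def using \<delta> \<epsilon> e by simp
  moreover have "dist (payoff g q \<theta> k (\<sigma> \<theta>) (\<tau> \<theta>) t) (t * limit_value g q k) < e"
    if \<theta>: "evaluation \<theta>" and norm: "\<bar>eval_norm \<theta>\<bar> < d" for \<theta>
  proof -
    have "eval_norm \<theta> < \<delta> * \<epsilon>" and n: "eval_norm \<theta> < e / (4 * (\<bar>L\<bar> + 1))"
      using norm by (auto simp: d_def)
    then have le: "\<bar>payoff g q \<theta> k (\<sigma> \<theta>) (\<tau> \<theta>) t - t * L\<bar> \<le>
        2 * \<eta> * (1 / \<epsilon> + 1) + (G + \<bar>L\<bar>) * \<epsilon> + \<bar>L\<bar> * eval_norm \<theta>"
      by (intro payoff_close[OF \<theta> t assms(1)[OF \<theta>] assms(2)[OF \<theta>] \<epsilon> \<eta>(1) _ bal' G])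
    have "\<bar>L\<bar> * eval_norm \<theta> \<le> (\<bar>L\<bar> + 1) * (e / (4 * (\<bar>L\<bar> + 1)))"
      using n e weight_le_eval_norm[OF \<theta>, of 0] evaluation_nonneg[OF \<theta>, of 0]
      by (intro mult_mono) auto
    also have "\<dots> = e / 4"
      by (simp add: field_simps)
    finally show ?thesis
      using le \<eta>(2) \<epsilon>_le e unfolding L dist_real_def by linarith
  qed
  ultimately show "\<forall>\<^sub>F \<theta> in vanishing. dist (payoff g q \<theta> k (\<sigma> \<theta>) (\<tau> \<theta>) t) (t * limit_value g q k) < e"
    unfolding eventually_vanishing by blast
qed

end

theorem corollary2p6:
  fixes g :: "'k::finite \<Rightarrow> 'i::finite \<Rightarrow> 'j::finite \<Rightarrow> real"
    and q :: "'k \<Rightarrow> 'i \<Rightarrow> 'j \<Rightarrow> 'k pmf"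
    and k :: 'k
    and x :: "real \<Rightarrow> 'k \<Rightarrow> 'i pmf"
    and y :: "real \<Rightarrow> 'k \<Rightarrow> 'j pmf"
    and \<sigma> :: "(nat \<Rightarrow> real) \<Rightarrow> ('k, 'i, 'j, 'i) strategy"
    and \<tau> :: "(nat \<Rightarrow> real) \<Rightarrow> ('k, 'i, 'j, 'j) strategy"
  assumes "absorbing_game q k"
    and "\<And>lam. 0 < lam \<Longrightarrow> lam \<le> 1 \<Longrightarrow> optimal1 g q lam (x lam)"
    and "\<And>lam. 0 < lam \<Longrightarrow> lam \<le> 1 \<Longrightarrow> optimal2 g q lam (y lam)"
    and "\<And>l i. puiseux_near_0 (\<lambda>lam. pmf (x lam l) i)"
    and "\<And>l j. puiseux_near_0 (\<lambda>lam. pmf (y lam l) j)"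
    and "\<And>\<theta>. evaluation \<theta> \<Longrightarrow> follows x \<theta> (\<sigma> \<theta>)"
    and "\<And>\<theta>. evaluation \<theta> \<Longrightarrow> follows y \<theta> (\<tau> \<theta>)"
  shows "\<forall>t\<in>{0..1}. ((\<lambda>\<theta>. payoff g q \<theta> k (\<sigma> \<theta>) (\<tau> \<theta>) t) \<longlongrightarrow> t * limit_value g q k) vanishing"
proof -
  interpret absorbing_optimal g q k x y
    by unfold_locales (use assms(1-5) in auto)
  show ?thesis
    using payoff_tendsto[OF assms(6,7)] by auto
qed

end
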